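(* Let $(Y_t)_{t\ge0}$ be a real-valued Lévy process, started in $y\in\mathbb R$ under $P_y$, let $r\in[0,\infty)$, and let $g:\mathbb R\to[0,\infty)$ satisfy $\{y:g(y)>0\}=\{y:y>b\}$ for some $b\in\mathbb R\cup\{-\infty\}$. Let $V(y)=\sup_\tau E_ye^{-r\tau}g(Y_\tau)$ and $S^*=\{y\in\mathbb R:V(y)=g(y)\}$, and assume the problem is non-trivial in the sense that $\inf S^*>b$. Assume that $g$ is increasing and log-concave on $\{y:y>b\}$ and that for every $y\in\mathbb R$: $E_y\sup_{t\ge0}e^{-rt}g(Y_t)<\infty$ and $e^{-rt}g(Y_t)\to0$ $P_y$-a.s. as $t\to\infty$. Then there exists $\alpha^*\in\mathbb R$ with $\alpha^*>b$ such that $$\tau^*=\inf\{t\ge0:Y_t\ge\alpha^*\}$$ is an optimal stopping time, i.e. $E_ye^{-r\tau^*}g(Y_{\tau^*})=V(y)$ for all $y\in\mathbb R$.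
   Context: The supremum in $V$ is over all stopping times $\tau$ (with values in $[0,\infty]$) with respect to the filtration $(\mathcal A_t)_{t\ge0}$ of the Lévy process, taken to satisfy the usual conditions; $Y$ has right-continuous paths with left limits. Convention: the reward $e^{-r\tau}g(Y_\tau)$ is $0$ on $\{\tau=\infty\}$ (also when $r=0$). $\inf\emptyset=\infty$. "Increasing" means non-decreasing; log-concave means that $\log g$ is concave. *)

theory Defs
  imports "HOL-Probability.Probability"
begin

text \<open>
  Filtrations are indexed by \<^typ>\<open>ennreal\<close>, so that the library notion \<^const>\<open>stopping_time\<close>
  gives stopping times with values in $[0,\infty]$. The \<open>\<sigma>\<close>-algebra at index \<open>\<infinity>\<close> carries no
  information for stopping times, since \<open>\<tau> \<le> \<infinity>\<close> holds trivially.
  Processes are indexed by \<^typ>\<open>real\<close>, and only their values at times \<open>t \<ge> 0\<close> are used.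
\<close>

locale levy_process = prob_space M + filtration "space M" F
  for M :: "'a measure" and F :: "ennreal \<Rightarrow> 'a measure" +
  fixes X :: "real \<Rightarrow> 'a \<Rightarrow> real"
  assumes subalgebra: "subalgebra M (F t)"
    and adapted: "t \<ge> 0 \<Longrightarrow> X t \<in> borel_measurable (F (ennreal t))"
    and starts_at_0: "AE \<omega> in M. X 0 \<omega> = 0"
    and independent_increments: "0 \<le> s \<Longrightarrow> s \<le> t \<Longrightarrow>
      indep_set (sets (F (ennreal s)))
        (sets (vimage_algebra (space M) (\<lambda>\<omega>. X t \<omega> - X s \<omega>) borel))"
    and stationary_increments: "0 \<le> s \<Longrightarrow> s \<le> t \<Longrightarrow>
      distr M borel (\<lambda>\<omega>. X t \<omega> - X s \<omega>) = distr M borel (X (t - s))"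
    and right_continuous: "\<omega> \<in> space M \<Longrightarrow> t \<ge> 0 \<Longrightarrow> continuous (at_right t) (\<lambda>u. X u \<omega>)"
    and left_limits: "\<omega> \<in> space M \<Longrightarrow> t > 0 \<Longrightarrow> \<exists>l. ((\<lambda>u. X u \<omega>) \<longlongrightarrow> l) (at_left t)"

definition usual_conditions :: "'a measure \<Rightarrow> (ennreal \<Rightarrow> 'a measure) \<Rightarrow> bool" where
  "usual_conditions M F \<longleftrightarrow>
     complete_measure M \<and> null_sets M \<subseteq> sets (F 0) \<and>
     (\<forall>t<\<infinity>. sets (F t) = (\<Inter>u\<in>{t<..}. sets (F u)))"

text \<open>
  In what follows \<open>X\<close> starts in 0, and the law $P_y$ of the process started in \<open>y\<close> is realised by
  the process \<open>Y = y + X\<close> under \<open>M\<close>: $E_y\,f(Y)$ is the integral of \<open>f (y + X)\<close> over \<open>M\<close>.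
  The rewards are nonnegative, so expectations are taken in \<^typ>\<open>ennreal\<close>.
\<close>

definition stopped_reward ::
  "(real \<Rightarrow> 'a \<Rightarrow> real) \<Rightarrow> real \<Rightarrow> (real \<Rightarrow> real) \<Rightarrow> real \<Rightarrow> ('a \<Rightarrow> ennreal) \<Rightarrow> 'a \<Rightarrow> real" where
  "stopped_reward X r g y \<tau> \<omega> =
     (if \<tau> \<omega> = \<infinity> then 0
      else exp (- r * enn2real (\<tau> \<omega>)) * g (y + X (enn2real (\<tau> \<omega>)) \<omega>))"

definition expected_reward ::
  "'a measure \<Rightarrow> (real \<Rightarrow> 'a \<Rightarrow> real) \<Rightarrow> real \<Rightarrow> (real \<Rightarrow> real) \<Rightarrow> real \<Rightarrow> ('a \<Rightarrow> ennreal) \<Rightarrow> ennreal"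
where
  "expected_reward M X r g y \<tau> = (\<integral>\<^sup>+\<omega>. ennreal (stopped_reward X r g y \<tau> \<omega>) \<partial>M)"

definition value_function ::
  "'a measure \<Rightarrow> (ennreal \<Rightarrow> 'a measure) \<Rightarrow> (real \<Rightarrow> 'a \<Rightarrow> real) \<Rightarrow> real \<Rightarrow> (real \<Rightarrow> real) \<Rightarrow> real \<Rightarrow> ennreal"
where
  "value_function M F X r g y = (SUP \<tau>\<in>{\<tau>. stopping_time F \<tau>}. expected_reward M X r g y \<tau>)"

definition stopping_set ::
  "'a measure \<Rightarrow> (ennreal \<Rightarrow> 'a measure) \<Rightarrow> (real \<Rightarrow> 'a \<Rightarrow> real) \<Rightarrow> real \<Rightarrow> (real \<Rightarrow> real) \<Rightarrow> real set"
where
  "stopping_set M F X r g = {y. value_function M F X r g y = ennreal (g y)}"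

definition threshold_time :: "(real \<Rightarrow> 'a \<Rightarrow> real) \<Rightarrow> real \<Rightarrow> real \<Rightarrow> 'a \<Rightarrow> ennreal" where
  "threshold_time X \<alpha> y \<omega> = Inf (ennreal ` {t. 0 \<le> t \<and> \<alpha> \<le> y + X t \<omega>})"

end

theory Submission
  imports Defs
begin

text \<open>
  The problem is first solved when stopping is allowed only on the dyadic grid of mesh
  \<open>1 / 2 ^ n\<close>, i.e. for a random walk. Let \<open>L g(x)\<close> be the expected discounted reward collected at
  the first strict ascending ladder epoch of the walk started in \<open>x\<close>. As ladder heights are positive,
  log-concavity makes \<open>L g / g\<close> non-increasing, so \<open>D\<^sub>n = {g > 0, L g \<le> g}\<close> is a half-line, on which
  \<open>g - L g\<close> is non-negative and (\<open>g\<close> being increasing) non-decreasing. A Wiener-Hopf type argument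
  then shows that the reward \<open>h\<^sub>n\<close> of stopping on entering \<open>D\<^sub>n\<close> is excessive, hence the value of the
  grid problem.

  As \<open>n\<close> grows, \<open>h\<^sub>n\<close> increases to \<open>V\<close> and \<open>D\<^sub>n\<close> shrinks to a half-line with left end point
  \<open>\<alpha>\<close>; non-triviality gives \<open>\<alpha> > b\<close>, and \<open>\<alpha> < \<infinity>\<close> since far above rewards can only be collected late.
  The walk enters \<open>D\<^sub>n\<close> only after the process has crossed any given level \<open>\<beta> < \<alpha>\<close> if \<open>n\<close> is large.
  By quasi-left-continuity the crossing times of \<open>\<beta>\<close> increase to \<open>\<tau>\<^sup>*\<close> as \<open>\<beta>\<close> increases to \<open>\<alpha>\<close>, with
  converging positions, so that \<open>h\<^sub>n \<le> g (max x \<alpha>)\<close> and dominated convergence give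
  \<open>V \<le> E exp(-r \<tau>\<^sup>*) g(Y(\<tau>\<^sup>*))\<close>. The same argument makes \<open>\<tau>\<^sup>*\<close> a stopping time.
\<close>

subsection \<open>Ladder epochs and first passage of discounted random walks\<close>

text \<open>The grid is forced by the ladder argument: in continuous time the process may exceed its
  starting point immediately, so that the first ladder epoch is 0 and comparing \<open>g\<close>
  with \<open>ladder g\<close> says nothing. On a grid a ladder epoch takes at least one step.

  Limits in the walk arguments rest on \<open>ladder_mass < 1\<close>: an inequality iterated over
  ladder epochs leaves an error \<open>ladder_mass ^ n * C\<close>. The discount gives this if
  \<open>r > 0\<close>, the decay of the rewards if \<open>r = 0\<close>.

  As \<open>g\<close> may jump at \<open>b\<close>, the reward is only lower semicontinuous along
  times decreasing to a limit. This is enough to round stopping times up to a grid and return by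
  Fatou. The limit at the threshold time also needs an upper estimate; positions there are at least
  \<alpha>, so \<alpha> > b makes \<open>g\<close> continuous.

  Stopping times are treated on the cells where their rounding is constant, which reduces the Markov
  property to deterministic times.\<close>

locale discounted_walk = prob_space \<mu> for \<mu> :: "real measure" +
  fixes q :: ennreal
  assumes sets_step: "sets \<mu> = sets borel" and discount_le_1: "q \<le> 1"
begin

lemma measurable_step [simp]: "borel_measurable \<mu> = borel_measurable borel"
  by (rule measurable_cong_sets) (simp_all add: sets_step)

definition trans :: "(real \<Rightarrow> ennreal) \<Rightarrow> real \<Rightarrow> ennreal" where
  "trans f x = q * (\<integral>\<^sup>+u. f (x + u) \<partial>\<mu>)"

text \<open>Expected discounted reward at the first visit of \<open>B\<close>, time 0 included, if
  it occurs within \<open>n\<close> steps. In this form facts about first visits become inductions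
  on \<open>n\<close>.\<close>

primrec hit_within :: "nat \<Rightarrow> real set \<Rightarrow> (real \<Rightarrow> ennreal) \<Rightarrow> real \<Rightarrow> ennreal" where
  "hit_within 0 B f = (\<lambda>u. if u \<in> B then f u else 0)"
| "hit_within (Suc n) B f = (\<lambda>u. if u \<in> B then f u else trans (hit_within n B f) u)"

definition hit :: "real set \<Rightarrow> (real \<Rightarrow> ennreal) \<Rightarrow> real \<Rightarrow> ennreal" where
  "hit B f u = (SUP n. hit_within n B f u)"

text \<open>For measurable \<open>f\<close> this is \<open>hit {x<..} f x\<close>, because
  \<open>x\<close> lies outside \<open>{x<..}\<close>. Splitting off the first step makes it
  comparable with \<open>trans\<close>, as in the last lines of
  \<open>trans_hit_le_hit\<close>.\<close>

definition ladder :: "(real \<Rightarrow> ennreal) \<Rightarrow> real \<Rightarrow> ennreal" where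
  "ladder f x = trans (hit {x<..} f) x"

lemma measurable_trans [measurable]:
  assumes [measurable]: "f \<in> borel_measurable borel"
  shows "trans f \<in> borel_measurable borel"
proof -
  have [measurable_cong]: "sets \<mu> = sets borel" by (rule sets_step)
  show ?thesis unfolding trans_def by measurable
qed

lemma trans_mono: "(\<And>u. f u \<le> f' u) \<Longrightarrow> trans f x \<le> trans f' x"
  unfolding trans_def by (intro mult_left_mono nn_integral_mono) auto

lemma trans_add:
  assumes [measurable]: "f \<in> borel_measurable borel" "f' \<in> borel_measurable borel"
  shows "trans (\<lambda>u. f u + f' u) x = trans f x + trans f' x"
  unfolding trans_def by (subst nn_integral_add) (auto simp: distrib_left)

lemma trans_cmult:
  assumes [measurable]: "f \<in> borel_measurable borel"
  shows "trans (\<lambda>u. c * f u) x = c * trans f x"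
  unfolding trans_def by (subst nn_integral_cmult) (auto simp: mult_ac)

lemma trans_SUP:
  assumes [measurable]: "\<And>n::nat. f n \<in> borel_measurable borel" and "\<And>u. incseq (\<lambda>n. f n u)"
  shows "trans (\<lambda>u. SUP n. f n u) x = (SUP n. trans (f n) x)"
proof -
  have "incseq (\<lambda>n u. f n (x + u))"
    using assms(2) by (auto simp: incseq_def le_fun_def)
  then show ?thesis
    unfolding trans_def
    by (subst nn_integral_monotone_convergence_SUP) (auto simp: SUP_mult_left_ennreal)
qed

lemma trans_1: "trans (\<lambda>u. 1) x = q"
  by (simp add: trans_def emeasure_space_1)

lemma trans_shift: "trans (\<lambda>v. f (v + d)) x = trans f (x + d)"
  unfolding trans_def by (simp add: add_ac)

lemma measurable_hit_within [measurable]: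
  assumes [measurable]: "B \<in> sets borel" "f \<in> borel_measurable borel"
  shows "hit_within n B f \<in> borel_measurable borel"
  by (induction n) simp_all

lemma hit_within_le_Suc: "hit_within n B f u \<le> hit_within (Suc n) B f u"
proof (induction n arbitrary: u)
  case (Suc n)
  then show ?case by (auto intro!: trans_mono)
qed simp

lemma incseq_hit_within: "incseq (\<lambda>n. hit_within n B f u)"
  by (rule incseq_SucI) (rule hit_within_le_Suc)

lemma hit_within_le_hit: "hit_within n B f u \<le> hit B f u"
  unfolding hit_def by (rule SUP_upper) simp

lemma measurable_hit [measurable]:
  assumes [measurable]: "B \<in> sets borel" "f \<in> borel_measurable borel"
  shows "hit B f \<in> borel_measurable borel"
  unfolding hit_def by measurable

lemma hit_in: "u \<in> B \<Longrightarrow> hit B f u = f u"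
proof -
  assume u: "u \<in> B"
  have "hit_within n B f u = f u" for n
    using u by (cases n) auto
  then show ?thesis by (simp add: hit_def)
qed

lemma hit_out:
  assumes [measurable]: "B \<in> sets borel" "f \<in> borel_measurable borel" and u: "u \<notin> B"
  shows "hit B f u = trans (hit B f) u"
proof -
  have "trans (hit B f) u = (SUP n. hit_within (Suc n) B f u)"
    using u unfolding hit_def[abs_def] by (subst trans_SUP) (auto intro: incseq_hit_within)
  also have "\<dots> = hit B f u"
    unfolding hit_def
    by (rule antisym)
      (auto intro!: SUP_mono intro: hit_within_le_Suc simp del: hit_within.simps)
  finally show ?thesis by simp
qed

text \<open>Optional stopping in functional form: a function that survives one step of the recursion
  bounds all \<open>hit_within\<close>, hence their supremum. Upper bounds on \<open>hit\<close>
  come from a choice of \<open>w\<close>.\<close>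

lemma hit_least:
  assumes "\<And>u. u \<in> B \<Longrightarrow> f u \<le> w u" "\<And>u. u \<notin> B \<Longrightarrow> trans w u \<le> w u"
  shows "hit B f u \<le> w u"
proof -
  have "hit_within n B f u \<le> w u" for n u
  proof (induction n arbitrary: u)
    case (Suc n)
    then show ?case
      using assms by (auto intro: order_trans[OF trans_mono])
  qed (use assms in auto)
  then show ?thesis unfolding hit_def by (auto intro: SUP_least)
qed

lemma hit_mono:
  assumes "\<And>u. u \<in> B \<Longrightarrow> f u \<le> f' u"
  shows "hit B f u \<le> hit B f' u"
proof -
  have "hit_within n B f u \<le> hit_within n B f' u" for n u
    using assms by (induction n arbitrary: u) (auto intro: trans_mono)
  then show ?thesis unfolding hit_def by (auto intro!: SUP_mono)
qed

lemma hit_within_add: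
  assumes [measurable]: "B \<in> sets borel" "f \<in> borel_measurable borel" "f' \<in> borel_measurable borel"
  shows "hit_within n B (\<lambda>u. f u + f' u) u = hit_within n B f u + hit_within n B f' u"
proof (induction n arbitrary: u)
  case (Suc n)
  then have "hit_within n B (\<lambda>u. f u + f' u) = (\<lambda>u. hit_within n B f u + hit_within n B f' u)"
    by auto
  then show ?case by (simp add: trans_add)
qed simp

lemma hit_add:
  assumes "B \<in> sets borel" "f \<in> borel_measurable borel" "f' \<in> borel_measurable borel"
  shows "hit B (\<lambda>u. f u + f' u) u = hit B f u + hit B f' u"
  unfolding hit_def hit_within_add[OF assms]
  by (intro ennreal_SUP_add incseq_hit_within)

lemma hit_within_cmult:
  assumes [measurable]: "B \<in> sets borel" "f \<in> borel_measurable borel"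
  shows "hit_within n B (\<lambda>u. c * f u) u = c * hit_within n B f u"
proof (induction n arbitrary: u)
  case (Suc n)
  then have "hit_within n B (\<lambda>u. c * f u) = (\<lambda>u. c * hit_within n B f u)"
    by auto
  then show ?case by (simp add: trans_cmult)
qed simp

lemma hit_cmult:
  assumes "B \<in> sets borel" "f \<in> borel_measurable borel"
  shows "hit B (\<lambda>u. c * f u) u = c * hit B f u"
  unfolding hit_def hit_within_cmult[OF assms] by (simp add: SUP_mult_left_ennreal)

lemma hit_1_le: "hit B (\<lambda>u. 1) u \<le> 1"
  by (rule hit_least) (auto simp: trans_1 discount_le_1)

lemma hit_shift:
  "hit {v. v + d \<in> B} (\<lambda>v. f (v + d)) u = hit B f (u + d)"
proof -
  have "hit_within n {v. v + d \<in> B} (\<lambda>v. f (v + d)) u = hit_within n B f (u + d)" for n u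
  proof (induction n arbitrary: u)
    case (Suc n)
    then have "hit_within n {v. v + d \<in> B} (\<lambda>v. f (v + d)) = (\<lambda>v. hit_within n B f (v + d))"
      by auto
    then show ?case by (simp add: trans_shift)
  qed simp
  then show ?thesis by (simp add: hit_def)
qed

text \<open>Strong Markov property at the first visit of \<open>B'\<close>: the walk cannot be in
  \<open>B\<close> earlier.\<close>

lemma hit_nested:
  assumes [measurable]: "B \<in> sets borel" "B' \<in> sets borel" "f \<in> borel_measurable borel"
    and sub: "B \<subseteq> B'"
  shows "hit B' (hit B f) u = hit B f u"
proof (rule antisym)
  show "hit B' (hit B f) u \<le> hit B f u"
  proof (rule hit_least)
    show "trans (hit B f) u \<le> hit B f u" if "u \<notin> B'" for u
    proof -
      have "u \<notin> B" using that sub by blast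
      then show ?thesis by (simp flip: hit_out)
    qed
  qed simp
  have "hit_within n B f u \<le> hit B' (hit B f) u" for n
  proof (induction n arbitrary: u)
    case 0
    then show ?case using sub by (auto simp: hit_in)
  next
    case (Suc n)
    show ?case
    proof (cases "u \<in> B'")
      case True
      then show ?thesis using hit_within_le_hit by (metis hit_in)
    next
      case False
      then have "u \<notin> B" using sub by auto
      with Suc False show ?thesis
        by (simp add: hit_out[of B'] trans_mono)
    qed
  qed
  then show "hit B f u \<le> hit B' (hit B f) u"
    unfolding hit_def[of B] by (auto intro: SUP_least)
qed

lemma ladder_mono: "(\<And>u. u > x \<Longrightarrow> f u \<le> f' u) \<Longrightarrow> ladder f x \<le> ladder f' x"
  unfolding ladder_def by (auto intro!: trans_mono hit_mono)

lemma ladder_add: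
  assumes [measurable]: "f \<in> borel_measurable borel" "f' \<in> borel_measurable borel"
  shows "ladder (\<lambda>u. f u + f' u) x = ladder f x + ladder f' x"
proof -
  have "hit {x<..} (\<lambda>u. f u + f' u) = (\<lambda>u. hit {x<..} f u + hit {x<..} f' u)"
    by (intro ext hit_add) simp_all
  then show ?thesis unfolding ladder_def by (simp add: trans_add)
qed

lemma ladder_cmult:
  assumes [measurable]: "f \<in> borel_measurable borel"
  shows "ladder (\<lambda>u. c * f u) x = c * ladder f x"
proof -
  have "hit {x<..} (\<lambda>u. c * f u) = (\<lambda>u. c * hit {x<..} f u)"
    by (intro ext hit_cmult) simp_all
  then show ?thesis unfolding ladder_def by (simp add: trans_cmult)
qed

lemma ladder_shift: "ladder (\<lambda>v. f (v + d)) x = ladder f (x + d)"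
proof -
  have "hit {x<..} (\<lambda>v. f (v + d)) = (\<lambda>u. hit {x + d<..} f (u + d))"
    using hit_shift[of d "{x + d<..}" f] by (auto simp: greaterThan_def)
  then show ?thesis unfolding ladder_def by (simp add: trans_shift)
qed

definition ladder_mass :: ennreal where
  "ladder_mass = ladder (\<lambda>u. 1) 0"

lemma ladder_1: "ladder (\<lambda>u. 1) x = ladder_mass"
  using ladder_shift[of "\<lambda>u. 1" x 0] by (simp add: ladder_mass_def)

lemma ladder_const: "ladder (\<lambda>u. c) x = c * ladder_mass"
  using ladder_cmult[of "\<lambda>u. 1" c x] by (simp add: ladder_1)

lemma ladder_mass_le: "ladder_mass \<le> q"
  using trans_mono[of "hit {0<..} (\<lambda>u. 1)" "\<lambda>u. 1" 0] hit_1_le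
  by (simp add: ladder_mass_def ladder_def trans_1)

text \<open>A set above \<open>x\<close> cannot be reached from \<open>x\<close> before the first
  ladder epoch.\<close>

lemma ladder_hit:
  assumes [measurable]: "B \<in> sets borel" "f \<in> borel_measurable borel"
    and B: "B \<subseteq> {x<..}"
  shows "ladder (hit B f) x = hit B f x"
proof -
  have "hit {x<..} (hit B f) = hit B f"
    using B by (auto simp: hit_nested)
  then show ?thesis
    using B unfolding ladder_def by (subst hit_out) auto
qed

section \<open>Iterated ladder inequalities: majorants and excessive functions\<close>

lemma ladder_mass_power:
  assumes "ladder_mass < 1" "C < \<infinity>"
  shows "(\<lambda>n. ladder_mass ^ n * C) \<longlonglongrightarrow> 0"
proof -
  obtain l c where l: "ladder_mass = ennreal l" "0 \<le> l" and c: "C = ennreal c" "0 \<le> c"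
    using assms by (metis ennreal_cases infinity_ennreal_def less_irrefl ennreal_one_less_top order_less_trans)
  have "l < 1" using assms(1) l by (metis ennreal_less_one_iff)
  then have "(\<lambda>n. l ^ n * c) \<longlonglongrightarrow> 0 * c"
    using l by (intro tendsto_mult tendsto_const LIMSEQ_power_zero) auto
  then have "(\<lambda>n. ennreal (l ^ n * c)) \<longlonglongrightarrow> ennreal 0"
    by (intro tendsto_ennrealI) simp
  then show ?thesis using l c by (simp add: ennreal_mult' ennreal_power)
qed

lemma le_add_ladder_mass_power:
  assumes "ladder_mass < 1" "C < \<infinity>" and le: "\<And>n. (a::ennreal) \<le> b + ladder_mass ^ n * C"
  shows "a \<le> b"
proof -
  have "(\<lambda>n. b + ladder_mass ^ n * C) \<longlonglongrightarrow> b + 0"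
    by (intro tendsto_add tendsto_const ladder_mass_power assms)
  then show ?thesis
    using le by (intro LIMSEQ_le_const[of _ b]) auto
qed

text \<open>Outside the up-set \<open>B\<close> waiting for the next ladder epoch does not lose, and
  \<open>B\<close> is entered only at ladder epochs. Postponing \<open>n\<close> times leaves an
  error of at most \<open>C\<close> times the mass \<open>ladder_mass ^ n\<close> of reaching the
  \<open>n\<close>-th epoch.\<close>

lemma le_hit_of_le_ladder:
  assumes [measurable]: "B \<in> sets borel" "f \<in> borel_measurable borel"
    and up: "\<And>x z. x \<in> B \<Longrightarrow> x \<le> z \<Longrightarrow> z \<in> B"
    and mass: "ladder_mass < 1"
    and bounded: "C < \<infinity>" "\<And>u. u \<notin> B \<Longrightarrow> f u \<le> C"
    and sub: "\<And>u. u \<notin> B \<Longrightarrow> f u \<le> ladder f u"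
  shows "f u \<le> hit B f u"
proof -
  have "f u \<le> hit B f u + ladder_mass ^ n * C" for n u
  proof (induction n arbitrary: u)
    case 0
    then show ?case
      using bounded(2)[of u] by (cases "u \<in> B") (auto simp: hit_in intro: add_increasing)
  next
    case (Suc n)
    show ?case
    proof (cases "u \<in> B")
      case False
      have B: "B \<subseteq> {u<..}"
        using up False by (force simp: not_le[symmetric])
      have "f u \<le> ladder f u" using sub False by auto
      also have "\<dots> \<le> ladder (\<lambda>v. hit B f v + ladder_mass ^ n * C) u"
        by (intro ladder_mono Suc)
      also have "\<dots> = hit B f u + ladder_mass ^ Suc n * C"
        using B by (subst ladder_add) (auto simp: ladder_hit ladder_const mult_ac)
      finally show ?thesis .
    qed (simp add: hit_in)
  qed
  then show ?thesis
    by (rule le_add_ladder_mass_power[OF mass bounded(1)])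
qed

text \<open>
  With \<open>h = hit D g\<close>, \<open>K = g - ladder g\<close> on \<open>D\<close> and \<open>K = 0\<close> elsewhere one has \<open>h = K + ladder h\<close>.
  Writing \<open>m u\<close> for the (killed) probability of never exceeding \<open>x\<close> from \<open>u \<le> x\<close>, also
  \<open>m = p + ladder m\<close> with \<open>p = 1 - ladder_mass\<close>. As \<open>K \<le> K x\<close> to the left of \<open>x\<close>, comparing the two
  equations gives \<open>h \<le> hit {x<..} h + (K x / p) m\<close>, and one step from \<open>x\<close> yields at most
  \<open>ladder h x + K x = h x\<close>.
\<close>

lemma trans_hit_le_hit:
  assumes [measurable]: "D \<in> sets borel" "g \<in> borel_measurable borel"
    and up: "\<And>x z. x \<in> D \<Longrightarrow> x \<le> z \<Longrightarrow> z \<in> D"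
    and mass: "ladder_mass < 1"
    and super: "\<And>x. x \<in> D \<Longrightarrow> ladder g x \<le> g x"
    and gain_mono: "\<And>x z. x \<in> D \<Longrightarrow> x \<le> z \<Longrightarrow> g x - ladder g x \<le> g z - ladder g z"
    and bounded: "\<And>x. \<exists>C<\<infinity>. \<forall>u\<le>x. hit D g u \<le> C"
  shows "trans (hit D g) x \<le> hit D g x"
proof (cases "x \<in> D")
  case False
  then show ?thesis by (simp flip: hit_out)
next
  case x: True
  define h where "h = hit D g"
  define e where "e = hit {x<..} (\<lambda>u. 1)"
  define m where "m u = 1 - e u" for u
  define p where "p = 1 - ladder_mass"
  define K where "K u = (if u \<in> D then g u - ladder g u else 0)" for u
  define \<kappa> where "\<kappa> = K x / p"
  have [measurable]: "h \<in> borel_measurable borel" "e \<in> borel_measurable borel"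
    by (simp_all add: h_def e_def)
  have [measurable]: "m \<in> borel_measurable borel"
    unfolding m_def by measurable
  have e_le: "e u \<le> 1" for u unfolding e_def by (rule hit_1_le)
  have me: "m u + e u = 1" for u
    unfolding m_def using e_le[of u] by (simp add: diff_add_cancel_ennreal)
  have p: "p + ladder_mass = 1" "p \<noteq> 0" "p \<noteq> \<infinity>"
    using mass by (auto simp: p_def diff_add_cancel_ennreal diff_eq_0_iff_ennreal)
  have \<kappa>: "\<kappa> * p = K x"
    using mult_divide_eq_ennreal[of p "K x"] p
    by (simp add: \<kappa>_def mult.commute[of _ p] mult.commute[of "K x"] ennreal_times_divide)
  have h_eq: "h u = K u + ladder h u" for u
  proof (cases "u \<in> D")
    case True
    \<comment> \<open>A ladder step from \<open>u\<close> in \<open>D\<close> lands above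
      \<open>u\<close>, hence in \<open>D\<close>, where \<open>h = g\<close>.\<close>
    have "ladder h u = ladder g u"
      using up[OF True] unfolding h_def
      by (intro antisym ladder_mono) (auto simp: hit_in)
    then show ?thesis
      using True super[OF True] by (simp add: h_def hit_in K_def diff_add_cancel_ennreal)
  next
    case False
    then have "D \<subseteq> {u<..}" using up by (force simp: not_le[symmetric])
    then show ?thesis using False by (simp add: h_def K_def ladder_hit)
  qed
  have K_le: "K u \<le> K x" if "u \<le> x" for u
    using that gain_mono[of u x] x by (auto simp: K_def)
  \<comment> \<open>Subtract \<open>ladder e u = e u\<close> from the equation for the constant 1.
    It needs \<open>u \<le> x\<close>, so that \<open>{x<..}\<close> lies above \<open>u\<close>;
    the final cancellation needs \<open>e u\<close> to be finite.\<close>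
  have ladder_m: "m u = p + ladder m u" if "u \<le> x" for u
  proof -
    have "ladder m u + ladder e u = ladder_mass"
      using ladder_add[of m e u] by (simp add: me ladder_1)
    moreover have "ladder e u = e u"
      unfolding e_def using that by (intro ladder_hit) auto
    ultimately have "m u + e u = p + ladder m u + e u"
      using p(1) me[of u] by (simp add: add.assoc)
    then have "e u + m u = e u + (p + ladder m u)"
      by (simp only: add.commute[of "e u"])
    moreover have "e u \<noteq> \<infinity>"
      using e_le[of u] by (auto simp: top_unique)
    ultimately show ?thesis
      unfolding ennreal_add_left_cancel by simp
  qed
  obtain C where C: "C < \<infinity>" "\<And>u. u \<le> x \<Longrightarrow> h u \<le> C"
    using bounded[of x] unfolding h_def by auto
  have "h u \<le> (hit {x<..} h u + \<kappa> * m u) + ladder_mass ^ n * C" for n u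
  proof (induction n arbitrary: u)
    case 0
    then show ?case
      using C(2)[of u] by (cases "u \<le> x") (auto simp: hit_in intro: add_increasing)
  next
    case (Suc n)
    show ?case
    proof (cases "u \<le> x")
      case True
      have "h u = K u + ladder h u" by (rule h_eq)
      also have "\<dots> \<le> K x + ladder (\<lambda>v. (hit {x<..} h v + \<kappa> * m v) + ladder_mass ^ n * C) u"
        by (intro add_mono K_le True ladder_mono Suc)
      also have "\<dots> = K x + (hit {x<..} h u + \<kappa> * ladder m u + ladder_mass ^ Suc n * C)"
        using True by (simp add: ladder_add ladder_hit ladder_cmult ladder_const mult_ac)
      also have "\<dots> = hit {x<..} h u + \<kappa> * m u + ladder_mass ^ Suc n * C"
        by (simp add: ladder_m[OF True] distrib_left \<kappa> add_ac)
      finally show ?thesis .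
    qed (simp add: hit_in add.assoc)
  qed
  then have h_le: "h u \<le> hit {x<..} h u + \<kappa> * m u" for u
    by (rule le_add_ladder_mass_power[OF mass C(1)])
  \<comment> \<open>\<open>trans e x\<close> is \<open>ladder_mass\<close> by the definition of
    \<open>ladder\<close>, so what remains of the total mass \<open>q \<le> 1\<close> is at most
    \<open>p\<close>.\<close>
  have m_le: "trans m x \<le> p"
  proof -
    have "trans m x + ladder_mass = q"
      using trans_add[of m e x] ladder_1[of x] by (simp add: me[unfolded e_def] trans_1 ladder_def e_def)
    then have "ladder_mass + trans m x \<le> ladder_mass + p"
      using discount_le_1 p(1) by (simp add: add.commute)
    moreover have "ladder_mass \<noteq> \<infinity>"
      using mass by auto
    ultimately show ?thesis
      unfolding ennreal_add_left_cancel_le by simp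
  qed
  have "trans h x \<le> trans (\<lambda>u. hit {x<..} h u + \<kappa> * m u) x"
    by (intro trans_mono h_le)
  also have "\<dots> = ladder h x + \<kappa> * trans m x"
    by (simp add: trans_add trans_cmult ladder_def)
  also have "\<dots> \<le> ladder h x + K x"
    unfolding \<kappa>[symmetric] by (intro add_left_mono mult_left_mono m_le) simp
  also have "\<dots> = h x" by (simp add: h_eq[of x] add.commute)
  finally show ?thesis unfolding h_def .
qed

text \<open>Log-concavity of \<open>g\<close> will provide \<open>ratio\<close>: it makes \<open>g (v + d) / g v\<close> non-increasing in \<open>v\<close>.\<close>

lemma ladder_ratio:
  assumes [measurable]: "g \<in> borel_measurable borel"
    and "0 \<le> d" and ratio: "\<And>v. x < v \<Longrightarrow> g x * g (v + d) \<le> g (x + d) * g v"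
  shows "g x * ladder g (x + d) \<le> g (x + d) * ladder g x"
proof -
  have "g x * ladder g (x + d) = ladder (\<lambda>v. g x * g (v + d)) x"
    by (simp add: ladder_shift[symmetric] ladder_cmult)
  also have "\<dots> \<le> ladder (\<lambda>v. g (x + d) * g v) x"
    by (intro ladder_mono ratio)
  also have "\<dots> = g (x + d) * ladder g x"
    by (simp add: ladder_cmult)
  finally show ?thesis .
qed

text \<open>Couple walks started at distance \<open>d\<close>: the shifted function
  \<open>hit B f (u + d)\<close> is superharmonic and dominates \<open>f\<close>, hence lies above
  \<open>hit B f u\<close> by \<open>hit_least\<close>.\<close>

lemma hit_mono_arg:
  assumes [measurable]: "B \<in> sets borel" "f \<in> borel_measurable borel" and "mono f"
    and majorant: "\<And>u. f u \<le> hit B f u"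
    and super: "\<And>u. trans (hit B f) u \<le> hit B f u"
  shows "mono (hit B f)"
proof (rule monoI)
  fix a c :: real assume "a \<le> c"
  define d where "d = c - a"
  have "hit B f a \<le> hit B f (a + d)"
  proof (rule hit_least[where w = "\<lambda>u. hit B f (u + d)"])
    fix u
    have "f u \<le> f (u + d)" using \<open>mono f\<close> \<open>a \<le> c\<close> by (auto simp: d_def mono_def)
    also have "\<dots> \<le> hit B f (u + d)" by (rule majorant)
    finally show "f u \<le> hit B f (u + d)" .
  qed (simp add: trans_shift super)
  then show "hit B f a \<le> hit B f c" by (simp add: d_def)
qed

end

subsection \<open>Right-continuous paths and dyadic rounding\<close>

lemma right_continuous_sequentially:
  fixes f :: "real \<Rightarrow> real"
  assumes f: "continuous (at_right t) f" and s: "s \<longlonglongrightarrow> t" and ge: "\<forall>\<^sub>F n in sequentially. t \<le> s n"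
  shows "(\<lambda>n. f (s n)) \<longlonglongrightarrow> f t"
proof -
  have "continuous (at t within {t..}) f"
    using f by (simp add: at_within_Ici_at_right continuous_within)
  then show ?thesis
    using s ge by (auto intro: continuous_within_tendsto_compose)
qed

lemma cadlag_bounded_above:
  fixes f :: "real \<Rightarrow> real"
  assumes rc: "\<And>t. 0 \<le> t \<Longrightarrow> continuous (at_right t) f"
    and ll: "\<And>t. 0 < t \<Longrightarrow> \<exists>l. (f \<longlongrightarrow> l) (at_left t)"
  shows "\<exists>C. \<forall>t\<in>{0..T}. f t \<le> C"
proof (cases "0 \<le> T")
  case True
  \<comment> \<open>The local condition of \<open>Bolzano\<close> also ranges over intervals around
    0 that start at negative times, where nothing is known about \<open>f\<close>; the premise
    \<open>0 \<le> a\<close> discards them.\<close>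
  define P where "P a c \<longleftrightarrow> 0 \<le> a \<longrightarrow> (\<exists>C. \<forall>t\<in>{a..c}. f t \<le> C)" for a c
  have "P 0 T"
  proof (rule Bolzano[OF True])
    fix a c d assume ac: "P a c" "P c d" "a \<le> c" "c \<le> d"
    show "P a d"
      unfolding P_def
    proof
      assume "0 \<le> a"
      then obtain C C' where "\<forall>t\<in>{a..c}. f t \<le> C" "\<forall>t\<in>{c..d}. f t \<le> C'"
        using ac by (auto simp: P_def)
      then have "\<forall>t\<in>{a..d}. f t \<le> max C C'"
        by (metis atLeastAtMost_iff le_max_iff_disj linear)
      then show "\<exists>C. \<forall>t\<in>{a..d}. f t \<le> C" by blast
    qed
  next
    fix t assume t: "0 \<le> t" "t \<le> T"
    have "(f \<longlongrightarrow> f t) (at_right t)"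
      using rc[OF t(1)] by (simp add: continuous_within)
    then have "\<forall>\<^sub>F u in at_right t. f u < f t + 1"
      by (rule order_tendstoD) simp
    then obtain d1 where d1: "d1 > t" "\<And>u. t < u \<Longrightarrow> u < d1 \<Longrightarrow> f u < f t + 1"
      by (auto simp: eventually_at_right_field)
    obtain C d2 where d2: "d2 < t" "\<And>u. d2 < u \<Longrightarrow> u < t \<Longrightarrow> 0 \<le> u \<Longrightarrow> f u < C"
    proof (cases "t = 0")
      case True
      show ?thesis by (rule that[of "-1"]) (use True in auto)
    next
      case False
      then obtain l where "(f \<longlongrightarrow> l) (at_left t)" using ll t by fastforce
      then have "\<forall>\<^sub>F u in at_left t. f u < l + 1"
        by (rule order_tendstoD) simp
      then show ?thesis
        using that by (auto simp: eventually_at_left_field)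
    qed
    have "P a c" if ac: "a \<le> t" "t \<le> c" "c - a < min (d1 - t) (t - d2)" for a c
      unfolding P_def
    proof
      assume "0 \<le> a"
      have "f u \<le> max (f t + 1) C" if "u \<in> {a..c}" for u
      proof (cases u t rule: linorder_cases)
        case less
        then have "f u < C" using ac that \<open>0 \<le> a\<close> by (intro d2(2)) auto
        then show ?thesis by simp
      next
        case greater
        then have "f u < f t + 1" using ac that by (intro d1(2)) auto
        then show ?thesis by simp
      qed auto
      then show "\<exists>C. \<forall>t\<in>{a..c}. f t \<le> C" by blast
    qed
    moreover have "0 < min (d1 - t) (t - d2)" using d1(1) d2(1) by simp
    ultimately show "\<exists>d>0. \<forall>a b. a \<le> t \<and> t \<le> b \<and> b - a < d \<longrightarrow> P a b"
      by blast
  qed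
  then show ?thesis by (simp add: P_def)
qed auto

text \<open>Meaningful for \<open>t < \<infinity>\<close> only: at \<open>\<infinity>\<close> the \<open>LEAST\<close> is taken over an empty predicate.\<close>

definition grid_index :: "nat \<Rightarrow> ennreal \<Rightarrow> nat" where
  "grid_index n t = (LEAST k. t \<le> ennreal (real k / 2 ^ n))"

definition grid_round :: "nat \<Rightarrow> ennreal \<Rightarrow> real" where
  "grid_round n t = real (grid_index n t) / 2 ^ n"

lemma grid_index_exists:
  assumes "t < \<infinity>" shows "\<exists>k. t \<le> ennreal (real k / 2 ^ n)"
proof -
  obtain x where x: "t = ennreal x" "0 \<le> x" using assms by (cases t) auto
  obtain k :: nat where "x * 2 ^ n \<le> real k" using real_arch_simple by blast
  then show ?thesis using x by (auto intro!: exI[of _ k] ennreal_leI simp: field_simps)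
qed

lemma grid_round_ge: "t < \<infinity> \<Longrightarrow> t \<le> ennreal (grid_round n t)"
  unfolding grid_round_def grid_index_def by (rule LeastI_ex) (rule grid_index_exists)

lemma less_grid_index: "k < grid_index n t \<Longrightarrow> ennreal (real k / 2 ^ n) < t"
  unfolding grid_index_def using not_less_Least by fastforce

lemma grid_index_eq_iff:
  assumes "t < \<infinity>"
  shows "grid_index n t = k \<longleftrightarrow> t \<le> ennreal (real k / 2 ^ n) \<and> (\<forall>j<k. ennreal (real j / 2 ^ n) < t)"
proof
  assume "grid_index n t = k"
  then show "t \<le> ennreal (real k / 2 ^ n) \<and> (\<forall>j<k. ennreal (real j / 2 ^ n) < t)"
    using grid_round_ge[OF assms, of n] less_grid_index[of _ n t] by (auto simp: grid_round_def)
next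
  assume "t \<le> ennreal (real k / 2 ^ n) \<and> (\<forall>j<k. ennreal (real j / 2 ^ n) < t)"
  then show "grid_index n t = k"
    unfolding grid_index_def by (intro Least_equality) (auto simp: not_le[symmetric])
qed

lemma grid_round_nonneg [simp]: "0 \<le> grid_round n t"
  by (simp add: grid_round_def)

lemma grid_round_bounds:
  assumes "0 \<le> t"
  shows "t \<le> grid_round n (ennreal t)" "grid_round n (ennreal t) \<le> t + 1 / 2 ^ n"
proof -
  show "t \<le> grid_round n (ennreal t)"
    using grid_round_ge[of "ennreal t" n] by (simp add: ennreal_le_iff)
  show "grid_round n (ennreal t) \<le> t + 1 / 2 ^ n"
  proof (cases "grid_index n (ennreal t)")
    case (Suc k)
    then have "ennreal (real k / 2 ^ n) < ennreal t"
      by (intro less_grid_index) simp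
    then have "real k / 2 ^ n < t" by (simp add: ennreal_less_iff)
    then show ?thesis using Suc by (simp add: grid_round_def add_divide_distrib)
  qed (use assms in \<open>simp add: grid_round_def\<close>)
qed

lemma grid_mesh_tendsto: "(\<lambda>n. 1 / 2 ^ n :: real) \<longlonglongrightarrow> 0"
  using LIMSEQ_power_zero[of "1/2 :: real"] by (simp add: power_one_over)

lemma grid_round_tendsto: "0 \<le> t \<Longrightarrow> (\<lambda>n. grid_round n (ennreal t)) \<longlonglongrightarrow> t"
proof (rule tendsto_sandwich[of "\<lambda>_. t" _ _ "\<lambda>n. t + 1 / 2 ^ n"])
  show "(\<lambda>n. t + 1 / 2 ^ n) \<longlonglongrightarrow> t"
    using tendsto_add[OF tendsto_const[of t] grid_mesh_tendsto] by simp
qed (auto intro: always_eventually grid_round_bounds)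

subsection \<open>Levy processes on dyadic grids\<close>

context levy_process
begin

lemma measurable_F_imp_M:
  assumes "f \<in> measurable (F (ennreal t)) N" shows "f \<in> measurable M N"
  using measurable_from_subalg[OF subalgebra assms] .

lemma sets_F_imp_M: "A \<in> sets (F (ennreal t)) \<Longrightarrow> A \<in> sets M"
  using subalgebra[of t] by (auto simp: subalgebra_def)

lemma random_X [measurable]: "0 \<le> t \<Longrightarrow> X t \<in> borel_measurable M"
  by (rule measurable_F_imp_M[OF adapted])

lemma adapted_le:
  assumes "0 \<le> s" "s \<le> t"
  shows "X s \<in> borel_measurable (F (ennreal t))"
proof -
  have "subalgebra (F (ennreal t)) (F (ennreal s))"
    using sets_F_mono[OF ennreal_leI[OF assms(2)]] by (simp add: subalgebra_def space_F)
  then show ?thesis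
    using adapted[OF assms(1)] by (rule measurable_from_subalg)
qed

text \<open>Independence and stationarity in one formula. The first component is the whole
  \<open>\<omega>\<close>, seen through the identity into \<open>F (ennreal s)\<close>, so that
  \<open>f\<close> may use all information up to time \<open>s\<close>.\<close>

lemma increment_nn_integral:
  assumes st: "0 \<le> s" "s \<le> t"
    and f [measurable]: "f \<in> borel_measurable (F (ennreal s) \<Otimes>\<^sub>M borel)"
  shows "(\<integral>\<^sup>+\<omega>. f (\<omega>, X t \<omega> - X s \<omega>) \<partial>M) =
    (\<integral>\<^sup>+\<omega>. \<integral>\<^sup>+u. f (\<omega>, u) \<partial>distr M borel (X (t - s)) \<partial>M)"
proof -
  let ?I = "\<lambda>\<omega>. X t \<omega> - X s \<omega>" and ?F = "F (ennreal s)"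
  have [measurable]: "?I \<in> borel_measurable M" using st by simp
  have id [measurable]: "(\<lambda>\<omega>. \<omega>) \<in> measurable M ?F"
    by (rule measurable_F_imp_M[of _ s]) simp
  interpret D1: prob_space "distr M ?F (\<lambda>\<omega>. \<omega>)" by (rule prob_space_distr) simp
  interpret D2: prob_space "distr M borel ?I" by (rule prob_space_distr) simp
  interpret D: pair_prob_space "distr M ?F (\<lambda>\<omega>. \<omega>)" "distr M borel ?I" ..
  have eq: "distr M ?F (\<lambda>\<omega>. \<omega>) \<Otimes>\<^sub>M distr M borel ?I = distr M (?F \<Otimes>\<^sub>M borel) (\<lambda>\<omega>. (\<omega>, ?I \<omega>))"
  proof (rule pair_measure_eqI)
    fix A B assume "A \<in> sets (distr M ?F (\<lambda>\<omega>. \<omega>))" "B \<in> sets (distr M borel ?I)"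
    then have AB [measurable]: "A \<in> sets ?F" "B \<in> sets borel" by auto
    have A: "(\<lambda>\<omega>. \<omega>) -` A \<inter> space M = A"
      using sets.sets_into_space[OF AB(1)] by (auto simp: space_F)
    have "?I -` B \<inter> space M \<in> sets (vimage_algebra (space M) ?I borel)"
      by (rule in_vimage_algebra) simp
    then have "prob (A \<inter> (?I -` B \<inter> space M)) = prob A * prob (?I -` B \<inter> space M)"
      by (rule indep_setD[OF independent_increments[OF st] AB(1)])
    moreover have "(\<lambda>\<omega>. (\<omega>, ?I \<omega>)) -` (A \<times> B) \<inter> space M = A \<inter> (?I -` B \<inter> space M)"
      using A by auto
    ultimately show "emeasure (distr M ?F (\<lambda>\<omega>. \<omega>)) A * emeasure (distr M borel ?I) B =
        emeasure (distr M (?F \<Otimes>\<^sub>M borel) (\<lambda>\<omega>. (\<omega>, ?I \<omega>))) (A \<times> B)"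
      using A by (simp add: emeasure_distr emeasure_eq_measure ennreal_mult)
  qed (simp_all add: D1.sigma_finite_measure_axioms D2.sigma_finite_measure_axioms cong: sets_pair_measure_cong)
  have [measurable_cong]: "sets (distr M borel (X (t - s))) = sets borel" by simp
  have sf: "sigma_finite_measure (distr M borel (X (t - s)))"
    unfolding stationary_increments[OF st, symmetric] ..
  have [measurable]: "(\<lambda>\<omega>. \<integral>\<^sup>+u. f (\<omega>, u) \<partial>distr M borel (X (t - s))) \<in> borel_measurable ?F"
    by (rule sigma_finite_measure.borel_measurable_nn_integral[OF sf]) simp
  have "(\<integral>\<^sup>+\<omega>. f (\<omega>, ?I \<omega>) \<partial>M) = (\<integral>\<^sup>+z. f z \<partial>distr M (?F \<Otimes>\<^sub>M borel) (\<lambda>\<omega>. (\<omega>, ?I \<omega>)))"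
    by (subst nn_integral_distr) simp_all
  also have "\<dots> = (\<integral>\<^sup>+\<omega>. \<integral>\<^sup>+u. f (\<omega>, u) \<partial>distr M borel ?I \<partial>distr M ?F (\<lambda>\<omega>. \<omega>))"
    unfolding eq[symmetric] by (subst D2.nn_integral_fst[symmetric]) simp_all
  also have "\<dots> = (\<integral>\<^sup>+\<omega>. \<integral>\<^sup>+u. f (\<omega>, u) \<partial>distr M borel (X (t - s)) \<partial>M)"
    unfolding stationary_increments[OF st] by (subst nn_integral_distr) simp_all
  finally show ?thesis .
qed

text \<open>Rounding up makes the event known at its own grid time \<open>k / 2 ^ n\<close>. Paths
  with \<open>\<tau> \<omega> = \<infinity>\<close> are excluded because \<open>grid_index\<close>
  carries no meaning there.\<close>

definition cell :: "nat \<Rightarrow> ('a \<Rightarrow> ennreal) \<Rightarrow> nat \<Rightarrow> 'a set" where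
  "cell n \<tau> k = {\<omega> \<in> space M. \<tau> \<omega> < \<infinity> \<and> grid_index n (\<tau> \<omega>) = k}"

lemma cell_in_F:
  assumes \<tau>: "stopping_time F \<tau>"
  shows "cell n \<tau> k \<in> sets (F (ennreal (real k / 2 ^ n)))"
proof -
  let ?t = "\<lambda>j. ennreal (real j / 2 ^ n)"
  have *: "{\<omega> \<in> space M. \<tau> \<omega> \<le> ?t j} \<in> sets (F (?t k))" if "j \<le> k" for j
  proof -
    have "{\<omega> \<in> space M. \<tau> \<omega> \<le> ?t j} \<in> sets (F (?t j))"
      using stopping_timeD[OF \<tau>, of "?t j"] by (simp add: pred_def space_F)
    moreover have "?t j \<le> ?t k" using that by (intro ennreal_leI divide_right_mono) auto
    ultimately show ?thesis using sets_F_mono by blast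
  qed
  have "cell n \<tau> k = {\<omega> \<in> space M. \<tau> \<omega> \<le> ?t k} - (\<Union>j<k. {\<omega> \<in> space M. \<tau> \<omega> \<le> ?t j})"
  proof (intro set_eqI)
    fix \<omega>
    show "\<omega> \<in> cell n \<tau> k \<longleftrightarrow>
      \<omega> \<in> {\<omega> \<in> space M. \<tau> \<omega> \<le> ?t k} - (\<Union>j<k. {\<omega> \<in> space M. \<tau> \<omega> \<le> ?t j})"
    proof (cases "\<tau> \<omega> < \<infinity>")
      case True
      then show ?thesis using grid_index_eq_iff[OF True, of n k] by (auto simp: cell_def not_le)
    next
      case False
      then show ?thesis by (auto simp: cell_def top_unique less_top[symmetric])
    qed
  qed
  also have "\<dots> \<in> sets (F (?t k))"
    by (intro sets.Diff sets.finite_UN *) auto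
  finally show ?thesis .
qed

lemma sum_cells:
  assumes "\<omega> \<in> space M"
  shows "(\<Sum>k. indicator (cell n \<tau> k) \<omega> * f k) =
    (if \<tau> \<omega> < \<infinity> then f (grid_index n (\<tau> \<omega>)) else (0::ennreal))"
proof (cases "\<tau> \<omega> < \<infinity>")
  case True
  have "(\<Sum>k. indicator (cell n \<tau> k) \<omega> * f k) = (\<Sum>k\<in>{grid_index n (\<tau> \<omega>)}. indicator (cell n \<tau> k) \<omega> * f k)"
    using True assms by (intro suminf_finite) (auto simp: cell_def indicator_def)
  also have "\<dots> = f (grid_index n (\<tau> \<omega>))"
    using True assms by (simp add: cell_def)
  finally show ?thesis using True by simp
qed (auto simp: cell_def indicator_def)

end

section \<open>The stopping problem: regularity of the gain and integrable envelopes\<close>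

locale monotone_stopping = levy_process M F X
  for M :: "'a measure" and F :: "ennreal \<Rightarrow> 'a measure" and X :: "real \<Rightarrow> 'a \<Rightarrow> real" +
  fixes r :: real and g :: "real \<Rightarrow> real" and b :: ereal
  assumes usual: "usual_conditions M F"
    and r_nonneg: "r \<ge> 0"
    and g_nonneg: "\<And>y. g y \<ge> 0"
    and b_not_infinity: "b \<noteq> \<infinity>"
    and support: "{y. g y > 0} = {y. ereal y > b}"
    and nontrivial: "Inf (ereal ` stopping_set M F X r g) > b"
    and increasing: "mono_on {y. ereal y > b} g"
    and log_concave: "concave_on {y. ereal y > b} (\<lambda>y. ln (g y))"
    and sup_integrable:
      "\<And>y. (\<integral>\<^sup>+\<omega>. (SUP t\<in>{0..}. ennreal (exp (- r * t) * g (y + X t \<omega>))) \<partial>M) < \<infinity>"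
    and vanishing: "\<And>y. AE \<omega> in M. ((\<lambda>t. exp (- r * t) * g (y + X t \<omega>)) \<longlongrightarrow> 0) at_top"
begin

lemma g_pos_iff: "0 < g y \<longleftrightarrow> b < ereal y"
  using support by auto

lemma g_eq_0: "\<not> b < ereal y \<Longrightarrow> g y = 0"
  using g_pos_iff[of y] g_nonneg[of y] by linarith

lemma mono_g: "mono g"
proof (rule monoI)
  fix x y :: real assume xy: "x \<le> y"
  show "g x \<le> g y"
  proof (cases "b < ereal x")
    case True
    moreover have "b < ereal y" using order_less_le_trans[OF True, of "ereal y"] xy by simp
    ultimately show ?thesis using increasing xy by (auto simp: mono_on_def)
  qed (simp add: g_eq_0 g_nonneg)
qed

lemma measurable_g [measurable]: "g \<in> borel_measurable borel"
  by (rule borel_measurable_mono[OF mono_g])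

lemma exists_support: "\<exists>x. b < ereal x"
  using b_not_infinity by (cases b) (auto intro: exI[of _ "real_of_ereal b + 1"])

lemma open_support: "open {y. b < ereal y}"
  by (cases b) (auto simp: greaterThan_def[symmetric])

text \<open>A concave function is continuous on an open interval; at \<open>b\<close> itself
  \<open>g\<close> may jump.\<close>

lemma isCont_g:
  assumes "b < ereal x" shows "isCont g x"
proof -
  have "continuous_on {y. b < ereal y} (\<lambda>y. - ln (g y))"
    using log_concave open_support by (intro convex_on_continuous) (auto simp: concave_on_def)
  then have "continuous_on {y. b < ereal y} (\<lambda>y. exp (- (- ln (g y))))"
    by (intro continuous_on_exp continuous_on_minus[of _ "\<lambda>y. - ln (g y)"])
  then have "continuous_on {y. b < ereal y} g"
    by (rule continuous_on_eq) (simp add: g_pos_iff)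
  then show ?thesis
    using assms open_support by (simp add: continuous_on_eq_continuous_at)
qed

text \<open>The points \<open>x + d\<close> and \<open>v\<close> divide the interval from
  \<open>x\<close> to \<open>v + d\<close> with interchanged weights \<open>\<theta>\<close> and
  \<open>1 - \<theta>\<close>, so the two concavity inequalities for \<open>ln g\<close> add up to
  the claim.\<close>

lemma g_ratio:
  assumes x: "b < ereal x" and "x \<le> v" "0 \<le> d"
  shows "g x * g (v + d) \<le> g (x + d) * g v"
proof (cases "v + d = x")
  case True
  then have "v = x" "d = 0" using assms by auto
  then show ?thesis by simp
next
  case False
  define L where "L = v + d - x"
  have L: "0 < L" using False assms by (simp add: L_def)
  define \<theta> where "\<theta> = d / L"
  have \<theta>: "0 \<le> \<theta>" "\<theta> \<le> 1" using assms L by (auto simp: \<theta>_def L_def)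
  have dL: "\<theta> * L = d" using L by (simp add: \<theta>_def)
  have up: "b < ereal z" if "x \<le> z" for z
    using order_less_le_trans[OF x, of "ereal z"] that by simp
  have cvx: "ln (g ((1 - t) * x + t * (v + d))) \<ge> (1 - t) * ln (g x) + t * ln (g (v + d))"
    if "0 \<le> t" "t \<le> 1" for t
    using concave_onD[OF log_concave that, of x "v + d"] up[of x] up[of "v + d"] assms
    by simp
  have 1: "(1 - \<theta>) * x + \<theta> * (v + d) = x + d"
    using dL by (simp add: L_def algebra_simps)
  have 2: "(1 - (1 - \<theta>)) * x + (1 - \<theta>) * (v + d) = v"
    using dL by (simp add: L_def algebra_simps)
  have "ln (g x) + ln (g (v + d)) \<le> ln (g (x + d)) + ln (g v)"
    using cvx[of \<theta>, unfolded 1] cvx[of "1 - \<theta>", unfolded 2] \<theta> by (simp add: algebra_simps)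
  moreover have "0 < g x" "0 < g (v + d)" "0 < g (x + d)" "0 < g v"
    using up assms by (auto simp: g_pos_iff)
  ultimately show ?thesis
    by (metis exp_add exp_le_cancel_iff exp_ln)
qed

definition gain :: "real \<Rightarrow> ennreal" where
  "gain u = ennreal (g u)"

lemma measurable_gain [measurable]: "gain \<in> borel_measurable borel"
  unfolding gain_def by measurable

lemma mono_gain: "mono gain"
  using mono_g by (auto simp: mono_def gain_def intro: ennreal_leI)

lemma gain_finite [simp]: "gain u < top" "gain u \<noteq> top"
  by (simp_all add: gain_def)

lemma gain_pos: "b < ereal u \<Longrightarrow> 0 < gain u"
  by (simp add: gain_def g_pos_iff)

definition reward :: "real \<Rightarrow> real \<Rightarrow> 'a \<Rightarrow> ennreal" where
  "reward y t \<omega> = ennreal (exp (- r * t) * g (y + X t \<omega>))"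

lemma reward_altdef: "reward y t \<omega> = ennreal (exp (- r * t)) * gain (y + X t \<omega>)"
  by (simp add: reward_def gain_def ennreal_mult g_nonneg)

lemma measurable_reward [measurable]: "0 \<le> t \<Longrightarrow> reward y t \<in> borel_measurable M"
  unfolding reward_def by measurable

lemma stopped_reward_eq:
  "ennreal (stopped_reward X r g y \<tau> \<omega>) = (if \<tau> \<omega> = \<infinity> then 0 else reward y (enn2real (\<tau> \<omega>)) \<omega>)"
  by (simp add: stopped_reward_def reward_def)

text \<open>Only one inequality is available, since \<open>g\<close> may jump upwards at
  \<open>b\<close>. Outside the open support the left-hand side vanishes; inside it \<open>g\<close>
  is continuous.\<close>

lemma reward_le_liminf:
  assumes "\<omega> \<in> space M" "0 \<le> t" "s \<longlonglongrightarrow> t" "\<And>n. t \<le> s n"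
  shows "reward y t \<omega> \<le> liminf (\<lambda>n. reward y (s n) \<omega>)"
proof (cases "b < ereal (y + X t \<omega>)")
  case True
  have "(\<lambda>n. X (s n) \<omega>) \<longlonglongrightarrow> X t \<omega>"
    by (rule right_continuous_sequentially[OF right_continuous])
      (use assms in \<open>auto intro: always_eventually\<close>)
  then have "(\<lambda>n. g (y + X (s n) \<omega>)) \<longlonglongrightarrow> g (y + X t \<omega>)"
    by (intro isCont_tendsto_compose[OF isCont_g[OF True]] tendsto_add tendsto_const)
  then have "(\<lambda>n. reward y (s n) \<omega>) \<longlonglongrightarrow> reward y t \<omega>"
    unfolding reward_def by (intro tendsto_ennrealI tendsto_mult tendsto_exp tendsto_const assms(3))
  then show ?thesis
    by (simp add: lim_imp_Liminf)
qed (simp add: reward_def g_eq_0)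

text \<open>
  Only dyadic times enter, because the supremum over all \<open>t \<ge> 0\<close> need not be measurable.
\<close>

definition envelope :: "ereal \<Rightarrow> real \<Rightarrow> 'a \<Rightarrow> ennreal" where
  "envelope z y \<omega> = (SUP (n, k). if z < ereal (y + X (real k / 2 ^ n) \<omega>)
     then reward y (real (k::nat) / 2 ^ (n::nat)) \<omega> else 0)"

lemma measurable_envelope [measurable]: "envelope z y \<in> borel_measurable M"
  unfolding envelope_def[abs_def] case_prod_beta by measurable

lemma reward_le_envelope_grid:
  "z < ereal (y + X (real k / 2 ^ n) \<omega>) \<Longrightarrow> reward y (real k / 2 ^ n) \<omega> \<le> envelope z y \<omega>"
  unfolding envelope_def by (rule SUP_upper2[of "(n, k)"]) auto

lemma reward_le_envelope:
  assumes "\<omega> \<in> space M" "0 \<le> t"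
  shows "reward y t \<omega> \<le> envelope (-\<infinity>) y \<omega>"
proof -
  have "reward y t \<omega> \<le> liminf (\<lambda>n. reward y (grid_round n (ennreal t)) \<omega>)"
    using assms by (intro reward_le_liminf grid_round_tendsto grid_round_bounds)
  also have "\<dots> \<le> limsup (\<lambda>n. reward y (grid_round n (ennreal t)) \<omega>)"
    by (rule Liminf_le_Limsup) simp
  also have "\<dots> \<le> envelope (-\<infinity>) y \<omega>"
    unfolding grid_round_def
    by (intro Limsup_bounded always_eventually allI reward_le_envelope_grid) simp
  finally show ?thesis .
qed

lemma envelope_mono: "z \<le> z' \<Longrightarrow> envelope z' y \<omega> \<le> envelope z y \<omega>"
  unfolding envelope_def by (intro SUP_mono') (auto intro: order_le_less_trans)

lemma envelope_integrable: "(\<integral>\<^sup>+\<omega>. envelope z y \<omega> \<partial>M) < \<infinity>"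
proof -
  have "envelope z y \<omega> \<le> (SUP t\<in>{0..}. ennreal (exp (- r * t) * g (y + X t \<omega>)))" for \<omega>
    unfolding envelope_def
  proof (rule SUP_least, clarsimp)
    fix n k
    show "reward y (real k / 2 ^ n) \<omega> \<le> (SUP t\<in>{0..}. ennreal (exp (- (r * t)) * g (y + X t \<omega>)))"
      unfolding reward_def by (rule SUP_upper2[of "real k / 2 ^ n"]) auto
  qed
  then have "(\<integral>\<^sup>+\<omega>. envelope z y \<omega> \<partial>M) \<le>
      (\<integral>\<^sup>+\<omega>. (SUP t\<in>{0..}. ennreal (exp (- r * t) * g (y + X t \<omega>))) \<partial>M)"
    by (intro nn_integral_mono)
  also have "\<dots> < \<infinity>" by (rule sup_integrable)
  finally show ?thesis .
qed

lemma mono_envelope_arg: "y \<le> y' \<Longrightarrow> envelope (-\<infinity>) y \<omega> \<le> envelope (-\<infinity>) y' \<omega>"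
  unfolding envelope_def reward_def
  by (intro SUP_mono') (auto intro!: ennreal_leI mult_left_mono monoD[OF mono_g])

text \<open>Far above, rewards can only be collected late, because paths are locally bounded.\<close>

lemma envelope_vanishes: "(\<lambda>j. \<integral>\<^sup>+\<omega>. envelope (ereal (real j)) y \<omega> \<partial>M) \<longlonglongrightarrow> 0"
proof -
  have "(\<lambda>j. \<integral>\<^sup>+\<omega>. envelope (ereal (real j)) y \<omega> \<partial>M) \<longlonglongrightarrow> (\<integral>\<^sup>+\<omega>. 0 \<partial>M)"
  proof (rule nn_integral_dominated_convergence[where w = "envelope (-\<infinity>) y"])
    show "AE \<omega> in M. (\<lambda>j. envelope (ereal (real j)) y \<omega>) \<longlonglongrightarrow> 0"
      using vanishing[of y] AE_space
    proof eventually_elim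
      case (elim \<omega>)
      show ?case
      proof (rule order_tendstoI)
        fix a :: ennreal assume "0 < a"
        then obtain c where c: "0 < c" "c < a" using dense by blast
        then obtain e where e: "c = ennreal e" "0 < e"
          by (cases c) auto
        have "\<forall>\<^sub>F t in at_top. exp (- r * t) * g (y + X t \<omega>) < e"
          using elim(1) e(2) by (rule order_tendstoD)
        then obtain t0 where t0: "\<And>t. t \<ge> t0 \<Longrightarrow> exp (- r * t) * g (y + X t \<omega>) < e"
          by (auto simp: eventually_at_top_linorder)
        have "\<exists>C. \<forall>t\<in>{0..t0}. X t \<omega> \<le> C"
          by (intro cadlag_bounded_above right_continuous left_limits elim(2))
        then obtain C where C: "\<And>t. 0 \<le> t \<Longrightarrow> t \<le> t0 \<Longrightarrow> X t \<omega> \<le> C"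
          by (meson atLeastAtMost_iff)
        have "envelope (ereal (real j)) y \<omega> \<le> c" if "y + C \<le> real j" for j
          unfolding envelope_def
        proof (rule SUP_least, clarsimp)
          fix n k assume "real j < y + X (real k / 2 ^ n) \<omega>"
          then have "\<not> real k / 2 ^ n \<le> t0"
            using C[of "real k / 2 ^ n"] that by auto
          then show "reward y (real k / 2 ^ n) \<omega> \<le> c"
            using t0[of "real k / 2 ^ n"] e by (auto simp: reward_def intro!: ennreal_leI)
        qed
        then have "envelope (ereal (real j)) y \<omega> < a" if "y + C \<le> real j" for j
          using that c(2) order_le_less_trans by blast
        moreover obtain j0 :: nat where "y + C \<le> real j0" using real_arch_simple by blast
        ultimately show "\<forall>\<^sub>F j in sequentially. envelope (ereal (real j)) y \<omega> < a"
          by (intro eventually_sequentiallyI[of j0]) simp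
      qed simp
    qed
  qed (use envelope_integrable in \<open>auto intro!: AE_I2 envelope_mono\<close>)
  then show ?thesis by simp
qed

subsection \<open>The process on a dyadic grid\<close>

definition discount :: "nat \<Rightarrow> ennreal" where
  "discount n = ennreal (exp (- r / 2 ^ n))"

definition step :: "nat \<Rightarrow> real measure" where
  "step n = distr M borel (X (1 / 2 ^ n))"

sublocale walk: discounted_walk "step n" "discount n" for n
proof (rule discounted_walk.intro)
  show "prob_space (step n)"
    unfolding step_def by (rule prob_space_distr) simp
  show "discounted_walk_axioms (step n) (discount n)"
    by unfold_locales (auto simp: step_def discount_def r_nonneg)
qed

abbreviation trans where "trans n \<equiv> discounted_walk.trans (step n) (discount n)"
abbreviation hit_within where "hit_within n \<equiv> discounted_walk.hit_within (step n) (discount n)"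
abbreviation hit where "hit n \<equiv> discounted_walk.hit (step n) (discount n)"
abbreviation ladder where "ladder n \<equiv> discounted_walk.ladder (step n) (discount n)"
abbreviation ladder_mass where "ladder_mass n \<equiv> discounted_walk.ladder_mass (step n) (discount n)"

definition grid :: "real \<Rightarrow> nat \<Rightarrow> nat \<Rightarrow> 'a \<Rightarrow> real" where
  "grid y n k \<omega> = y + X (real k / 2 ^ n) \<omega>"

lemma measurable_grid [measurable]: "grid y n k \<in> borel_measurable M"
  unfolding grid_def by measurable

lemma discount_power: "discount n ^ k = ennreal (exp (- r * (real k / 2 ^ n)))"
  by (simp add: discount_def ennreal_power exp_of_nat_mult[symmetric])

lemma discounted_gain_grid: "discount n ^ k * gain (grid y n k \<omega>) = reward y (real k / 2 ^ n) \<omega>"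
  by (simp add: discount_power reward_altdef grid_def)

lemma grid_0: "AE \<omega> in M. grid y n 0 \<omega> = y"
  using starts_at_0 by eventually_elim (simp add: grid_def)

lemma grid_markov:
  assumes A: "A \<in> sets (F (ennreal (real k / 2 ^ n)))" and f [measurable]: "f \<in> borel_measurable borel"
  shows "(\<integral>\<^sup>+\<omega>. indicator A \<omega> * (discount n ^ Suc k * f (grid y n (Suc k) \<omega>)) \<partial>M) =
    (\<integral>\<^sup>+\<omega>. indicator A \<omega> * (discount n ^ k * trans n f (grid y n k \<omega>)) \<partial>M)"
proof -
  let ?s = "real k / 2 ^ n" and ?t = "real (Suc k) / 2 ^ n"
  note A' [measurable] = sets_F_imp_M[OF A]
  have [measurable]: "A \<in> sets (F (ennreal ?s))" "X ?s \<in> borel_measurable (F (ennreal ?s))"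
    using A adapted by auto
  have [measurable_cong]: "sets (step n) = sets borel" by (rule walk.sets_step)
  have ts: "?t - ?s = 1 / 2 ^ n" by (simp add: field_simps)
  have "(\<integral>\<^sup>+\<omega>. indicator A \<omega> * f (grid y n (Suc k) \<omega>) \<partial>M) =
      (\<integral>\<^sup>+\<omega>. (\<lambda>(\<omega>, u). indicator A \<omega> * f (y + X ?s \<omega> + u)) (\<omega>, X ?t \<omega> - X ?s \<omega>) \<partial>M)"
    by (simp add: grid_def)
  also have "\<dots> = (\<integral>\<^sup>+\<omega>. \<integral>\<^sup>+u. indicator A \<omega> * f (y + X ?s \<omega> + u) \<partial>step n \<partial>M)"
    unfolding step_def ts[symmetric]
    by (subst increment_nn_integral) (simp_all add: divide_right_mono)
  also have "\<dots> = (\<integral>\<^sup>+\<omega>. indicator A \<omega> * (\<integral>\<^sup>+u. f (grid y n k \<omega> + u) \<partial>step n) \<partial>M)"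
    by (simp add: nn_integral_cmult grid_def)
  finally have eq: "(\<integral>\<^sup>+\<omega>. indicator A \<omega> * f (grid y n (Suc k) \<omega>) \<partial>M) =
    (\<integral>\<^sup>+\<omega>. indicator A \<omega> * (\<integral>\<^sup>+u. f (grid y n k \<omega> + u) \<partial>step n) \<partial>M)" .
  have "(\<integral>\<^sup>+\<omega>. indicator A \<omega> * (discount n ^ Suc k * f (grid y n (Suc k) \<omega>)) \<partial>M) =
      discount n ^ Suc k * (\<integral>\<^sup>+\<omega>. indicator A \<omega> * f (grid y n (Suc k) \<omega>) \<partial>M)"
    by (subst nn_integral_cmult[symmetric]) (auto intro!: nn_integral_cong simp: mult_ac)
  also have "\<dots> = (\<integral>\<^sup>+\<omega>. indicator A \<omega> * (discount n ^ k * trans n f (grid y n k \<omega>)) \<partial>M)"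
    unfolding eq
    by (subst nn_integral_cmult[symmetric])
      (auto intro!: nn_integral_cong simp: walk.trans_def mult_ac)
  finally show ?thesis .
qed

text \<open>Pathwise version of \<open>hit_within\<close>, started at grid time \<open>k\<close>.
  The discount is counted from time 0, so passing to the next grid time needs no correction
  factor.\<close>

primrec hit_reward :: "real \<Rightarrow> nat \<Rightarrow> real set \<Rightarrow> (real \<Rightarrow> ennreal) \<Rightarrow> nat \<Rightarrow> nat \<Rightarrow> 'a \<Rightarrow> ennreal" where
  "hit_reward y n B f 0 k \<omega> = (if grid y n k \<omega> \<in> B then discount n ^ k * f (grid y n k \<omega>) else 0)"
| "hit_reward y n B f (Suc N) k \<omega> =
    (if grid y n k \<omega> \<in> B then discount n ^ k * f (grid y n k \<omega>) else hit_reward y n B f N (Suc k) \<omega>)"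

lemma measurable_hit_reward [measurable]:
  assumes [measurable]: "B \<in> sets borel" "f \<in> borel_measurable borel"
  shows "hit_reward y n B f N k \<in> borel_measurable M"
proof (induction N arbitrary: k)
  case 0
  show ?case unfolding hit_reward.simps by measurable
next
  case (Suc N)
  note [measurable] = Suc
  show ?case unfolding hit_reward.simps by measurable
qed

lemma hit_reward_le_Suc: "hit_reward y n B f N k \<omega> \<le> hit_reward y n B f (Suc N) k \<omega>"
proof (induction N arbitrary: k)
  case (Suc N)
  then show ?case by auto
qed simp

text \<open>Looking \<open>N\<close> steps ahead from \<open>k\<close> instead of from 0 extends the
  horizon, hence only an inequality.\<close>

lemma hit_reward_shift:
  assumes "\<And>j. j < k \<Longrightarrow> grid y n j \<omega> \<notin> B"
  shows "hit_reward y n B f N 0 \<omega> \<le> hit_reward y n B f N k \<omega>"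
  using assms
proof (induction k)
  case (Suc k)
  then have "hit_reward y n B f N 0 \<omega> \<le> hit_reward y n B f N k \<omega>" by simp
  also have "\<dots> \<le> hit_reward y n B f (Suc N) k \<omega>" by (rule hit_reward_le_Suc)
  also have "\<dots> = hit_reward y n B f N (Suc k) \<omega>" using Suc by simp
  finally show ?case .
qed simp

lemma hit_reward_le_SUP:
  "hit_reward y n B f N k \<omega> \<le>
    (SUP i\<in>{k..}. if grid y n i \<omega> \<in> B then discount n ^ i * f (grid y n i \<omega>) else 0)"
proof (induction N arbitrary: k)
  case 0
  then show ?case by (intro SUP_upper2[of k]) auto
next
  case (Suc N)
  show ?case
  proof (cases "grid y n k \<omega> \<in> B")
    case True
    then show ?thesis by (intro SUP_upper2[of k]) auto
  next
    case False
    then have "hit_reward y n B f (Suc N) k \<omega> = hit_reward y n B f N (Suc k) \<omega>" by simp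
    also note Suc[of "Suc k"]
    finally show ?thesis by (rule order_trans) (intro SUP_subset_mono, auto)
  qed
qed

text \<open>The event \<open>A\<close> is carried along because the induction splits it according to
  whether the walk is in \<open>B\<close> at time \<open>k\<close>; later \<open>A\<close> is a cell
  of a rounded crossing time.\<close>

lemma hit_within_grid:
  assumes [measurable]: "B \<in> sets borel" "f \<in> borel_measurable borel"
    and A: "A \<in> sets (F (ennreal (real k / 2 ^ n)))"
  shows "(\<integral>\<^sup>+\<omega>. indicator A \<omega> * (discount n ^ k * hit_within n N B f (grid y n k \<omega>)) \<partial>M) =
    (\<integral>\<^sup>+\<omega>. indicator A \<omega> * hit_reward y n B f N k \<omega> \<partial>M)"
  using A
proof (induction N arbitrary: k A)
  case 0
  show ?case by (auto intro!: nn_integral_cong)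
next
  case (Suc N)
  let ?s = "real k / 2 ^ n" and ?t = "real (Suc k) / 2 ^ n"
  have adapt: "grid y n k \<in> borel_measurable (F (ennreal ?s))"
    unfolding grid_def using adapted[of ?s] by simp
  have hits: "{\<omega> \<in> space M. grid y n k \<omega> \<in> B} \<in> sets (F (ennreal ?s))"
    using measurable_sets[OF adapt assms(1)] by (simp add: vimage_def Int_def space_F conj_commute)
  define A1 where "A1 = A \<inter> {\<omega> \<in> space M. grid y n k \<omega> \<in> B}"
  define A2 where "A2 = A - {\<omega> \<in> space M. grid y n k \<omega> \<in> B}"
  have A12: "A1 \<in> sets (F (ennreal ?s))" "A2 \<in> sets (F (ennreal ?s))"
    using Suc.prems hits by (auto simp: A1_def A2_def)
  then have A2': "A2 \<in> sets (F (ennreal ?t))"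
    using sets_F_mono[of "ennreal ?s" "ennreal ?t"] by (auto simp: ennreal_leI divide_right_mono)
  have [measurable]: "A1 \<in> sets M" "A2 \<in> sets M"
    using A12 by (auto intro: sets_F_imp_M)
  have ind: "indicator A \<omega> = (indicator A1 \<omega> + indicator A2 \<omega> :: ennreal)" if "\<omega> \<in> space M" for \<omega>
    using that by (auto simp: A1_def A2_def indicator_def)
  have "(\<integral>\<^sup>+\<omega>. indicator A \<omega> * (discount n ^ k * hit_within n (Suc N) B f (grid y n k \<omega>)) \<partial>M) =
    (\<integral>\<^sup>+\<omega>. indicator A1 \<omega> * (discount n ^ k * f (grid y n k \<omega>)) +
       indicator A2 \<omega> * (discount n ^ k * trans n (hit_within n N B f) (grid y n k \<omega>)) \<partial>M)"
    by (intro nn_integral_cong) (auto simp: A1_def A2_def indicator_def)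
  also have "\<dots> = (\<integral>\<^sup>+\<omega>. indicator A1 \<omega> * (discount n ^ k * f (grid y n k \<omega>)) \<partial>M) +
      (\<integral>\<^sup>+\<omega>. indicator A2 \<omega> * (discount n ^ k * trans n (hit_within n N B f) (grid y n k \<omega>)) \<partial>M)"
    by (intro nn_integral_add) measurable
  also have "(\<integral>\<^sup>+\<omega>. indicator A2 \<omega> * (discount n ^ k * trans n (hit_within n N B f) (grid y n k \<omega>)) \<partial>M) =
      (\<integral>\<^sup>+\<omega>. indicator A2 \<omega> * hit_reward y n B f N (Suc k) \<omega> \<partial>M)"
    unfolding Suc.IH[OF A2', symmetric] using A12(2) 
    by (intro grid_markov[symmetric] walk.measurable_hit_within assms(1,2))
  also have "(\<integral>\<^sup>+\<omega>. indicator A1 \<omega> * (discount n ^ k * f (grid y n k \<omega>)) \<partial>M) + \<dots> =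
      (\<integral>\<^sup>+\<omega>. indicator A1 \<omega> * (discount n ^ k * f (grid y n k \<omega>)) +
        indicator A2 \<omega> * hit_reward y n B f N (Suc k) \<omega> \<partial>M)"
    by (intro nn_integral_add[symmetric]) measurable
  also have "\<dots> = (\<integral>\<^sup>+\<omega>. indicator A \<omega> * hit_reward y n B f (Suc N) k \<omega> \<partial>M)"
    by (intro nn_integral_cong) (auto simp: A1_def A2_def indicator_def)
  finally show ?case .
qed

lemma hit_eq_SUP:
  assumes [measurable]: "B \<in> sets borel" "f \<in> borel_measurable borel"
  shows "hit n B f y = (SUP N. \<integral>\<^sup>+\<omega>. hit_reward y n B f N 0 \<omega> \<partial>M)"
proof -
  have "hit_within n N B f y = (\<integral>\<^sup>+\<omega>. hit_reward y n B f N 0 \<omega> \<partial>M)" for N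
  proof -
    have "(\<integral>\<^sup>+\<omega>. hit_reward y n B f N 0 \<omega> \<partial>M) =
        (\<integral>\<^sup>+\<omega>. indicator (space M) \<omega> * hit_reward y n B f N 0 \<omega> \<partial>M)"
      by (intro nn_integral_cong) simp
    also have "\<dots> = (\<integral>\<^sup>+\<omega>. indicator (space M) \<omega> * (discount n ^ 0 * hit_within n N B f (grid y n 0 \<omega>)) \<partial>M)"
      using sets.top[of "F (ennreal (real 0 / 2 ^ n))"]
      by (subst hit_within_grid) (simp_all add: space_F)
    also have "\<dots> = (\<integral>\<^sup>+\<omega>. hit_within n N B f y \<partial>M)"
      using grid_0[of y n] AE_space
      by (intro nn_integral_cong_AE, eventually_elim) simp
    finally show ?thesis by (simp add: emeasure_space_1)
  qed
  then show ?thesis by (simp add: walk.hit_def)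
qed

lemma hit_le_envelope:
  assumes "B \<in> sets borel" and above: "\<And>x. x \<in> B \<Longrightarrow> z < ereal x"
  shows "hit n B gain y \<le> (\<integral>\<^sup>+\<omega>. envelope z y \<omega> \<partial>M)"
proof -
  have le: "discount n ^ i * gain (grid y n i \<omega>) \<le> envelope z y \<omega>" if "z < ereal (grid y n i \<omega>)" for i \<omega>
    unfolding discounted_gain_grid
    using that by (intro reward_le_envelope_grid) (simp add: grid_def)
  have "hit_reward y n B gain N 0 \<omega> \<le> envelope z y \<omega>" for N \<omega>
  proof (rule order_trans[OF hit_reward_le_SUP], rule SUP_least)
    fix i
    show "(if grid y n i \<omega> \<in> B then discount n ^ i * gain (grid y n i \<omega>) else 0) \<le> envelope z y \<omega>"
      using above le by auto
  qed
  then show ?thesis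
    using assms by (auto simp: hit_eq_SUP intro!: SUP_least nn_integral_mono)
qed

section \<open>Optional stopping on the grid and upper bounds for the value\<close>

lemma supermartingale_bound:
  assumes \<tau>: "stopping_time F \<tau>" and [measurable]: "w \<in> borel_measurable borel"
    and super: "\<And>x. trans n w x \<le> w x"
  shows "(\<integral>\<^sup>+\<omega>. (\<Sum>k. indicator (cell n \<tau> k) \<omega> * (discount n ^ k * w (grid y n k \<omega>))) \<partial>M) \<le> w y"
proof -
  note cell_in_F[OF \<tau>, of n]
  then have [measurable]: "cell n \<tau> k \<in> sets M" for k by (rule sets_F_imp_M)
  define v where "v k \<omega> = discount n ^ k * w (grid y n k \<omega>)" for k \<omega>
  have [measurable]: "v k \<in> borel_measurable M" for k unfolding v_def by measurable
  \<comment> \<open>\<open>A k\<close> says that the rounded time is not below \<open>k\<close>. The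
    event \<open>A (Suc k)\<close> is already known at grid time \<open>k\<close>, which lets the
    step from \<open>k\<close> to \<open>Suc k\<close> be integrated out.\<close>
  define A where "A k = space M - (\<Union>j<k. cell n \<tau> j)" for k
  have A_F: "A (Suc k) \<in> sets (F (ennreal (real k / 2 ^ n)))" for k
  proof -
    have "cell n \<tau> j \<in> sets (F (ennreal (real k / 2 ^ n)))" if "j < Suc k" for j
      using cell_in_F[OF \<tau>, of n j] that
        sets_F_mono[of "ennreal (real j / 2 ^ n)" "ennreal (real k / 2 ^ n)"]
      by (auto simp: ennreal_leI divide_right_mono)
    then have "space (F (ennreal (real k / 2 ^ n))) - (\<Union>j<Suc k. cell n \<tau> j) \<in> sets (F (ennreal (real k / 2 ^ n)))"
      by (intro sets.Diff sets.top sets.finite_UN) auto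
    then show ?thesis by (simp add: A_def space_F)
  qed
  have [measurable]: "A k \<in> sets M" for k unfolding A_def by measurable
  have split: "indicator (A k) \<omega> = (indicator (cell n \<tau> k) \<omega> + indicator (A (Suc k)) \<omega> :: ennreal)"
    if "\<omega> \<in> space M" for k \<omega>
    using that by (auto simp: A_def indicator_def cell_def less_Suc_eq)
  \<comment> \<open>What has been collected before \<open>N\<close> plus what the paths still
    running hold at \<open>N\<close>: this total starts at \<open>w y\<close> and cannot
    grow.\<close>
  have bound: "(\<Sum>k<N. \<integral>\<^sup>+\<omega>. indicator (cell n \<tau> k) \<omega> * v k \<omega> \<partial>M) + (\<integral>\<^sup>+\<omega>. indicator (A N) \<omega> * v N \<omega> \<partial>M) \<le> w y" for N
  proof (induction N)
    case 0
    have "(\<integral>\<^sup>+\<omega>. indicator (A 0) \<omega> * v 0 \<omega> \<partial>M) = (\<integral>\<^sup>+\<omega>. w y \<partial>M)"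
      using grid_0[of y n] AE_space
      by (intro nn_integral_cong_AE, eventually_elim) (simp add: A_def v_def)
    then show ?case by (simp add: emeasure_space_1)
  next
    case (Suc N)
    have "(\<integral>\<^sup>+\<omega>. indicator (A (Suc N)) \<omega> * v (Suc N) \<omega> \<partial>M) =
        (\<integral>\<^sup>+\<omega>. indicator (A (Suc N)) \<omega> * (discount n ^ N * trans n w (grid y n N \<omega>)) \<partial>M)"
      unfolding v_def by (intro grid_markov A_F) simp
    also have "\<dots> \<le> (\<integral>\<^sup>+\<omega>. indicator (A (Suc N)) \<omega> * v N \<omega> \<partial>M)"
      unfolding v_def by (intro nn_integral_mono mult_left_mono super) auto
    finally have "(\<integral>\<^sup>+\<omega>. indicator (cell n \<tau> N) \<omega> * v N \<omega> \<partial>M) + (\<integral>\<^sup>+\<omega>. indicator (A (Suc N)) \<omega> * v (Suc N) \<omega> \<partial>M)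
        \<le> (\<integral>\<^sup>+\<omega>. indicator (cell n \<tau> N) \<omega> * v N \<omega> \<partial>M) + (\<integral>\<^sup>+\<omega>. indicator (A (Suc N)) \<omega> * v N \<omega> \<partial>M)"
      by (rule add_left_mono)
    also have "\<dots> = (\<integral>\<^sup>+\<omega>. indicator (A N) \<omega> * v N \<omega> \<partial>M)"
      by (subst nn_integral_add[symmetric])
        (auto intro!: nn_integral_cong simp: split[of _ N] distrib_right)
    finally have "(\<Sum>k<N. \<integral>\<^sup>+\<omega>. indicator (cell n \<tau> k) \<omega> * v k \<omega> \<partial>M) +
        ((\<integral>\<^sup>+\<omega>. indicator (cell n \<tau> N) \<omega> * v N \<omega> \<partial>M) + (\<integral>\<^sup>+\<omega>. indicator (A (Suc N)) \<omega> * v (Suc N) \<omega> \<partial>M)) \<le>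
        (\<Sum>k<N. \<integral>\<^sup>+\<omega>. indicator (cell n \<tau> k) \<omega> * v k \<omega> \<partial>M) + (\<integral>\<^sup>+\<omega>. indicator (A N) \<omega> * v N \<omega> \<partial>M)"
      by (rule add_left_mono)
    also note Suc
    finally show ?case by (simp only: sum.lessThan_Suc add.assoc)
  qed
  have "(\<Sum>k<N. \<integral>\<^sup>+\<omega>. indicator (cell n \<tau> k) \<omega> * v k \<omega> \<partial>M) \<le> w y" for N
    using bound[of N] by (rule order_trans[rotated]) simp
  then have "(\<Sum>k. \<integral>\<^sup>+\<omega>. indicator (cell n \<tau> k) \<omega> * v k \<omega> \<partial>M) \<le> w y"
    by (intro suminf_le_const) auto
  then show ?thesis
    unfolding v_def[symmetric] by (subst nn_integral_suminf) auto
qed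

text \<open>Round a stopping time up to each grid, bound the reward there by optional stopping, and
  return by Fatou. Every grid may have its own excessive majorant \<open>w n\<close>; only the bound
  \<open>c\<close> is common.\<close>

lemma value_le:
  assumes "\<And>n. w n \<in> borel_measurable borel" "\<And>n x. trans n (w n) x \<le> w n x"
    and "\<And>n x. gain x \<le> w n x" and "\<And>n. w n y \<le> c"
  shows "value_function M F X r g y \<le> c"
  unfolding value_function_def
proof (rule SUP_least, clarsimp)
  fix \<tau> :: "'a \<Rightarrow> ennreal" assume \<tau>: "stopping_time F \<tau>"
  have [measurable]: "cell n \<tau> k \<in> sets M" for k n
    using cell_in_F[OF \<tau>, of n] by (rule sets_F_imp_M)
  let ?R = "\<lambda>n \<omega>. \<Sum>k. indicator (cell n \<tau> k) \<omega> * (discount n ^ k * gain (grid y n k \<omega>))"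
  have "expected_reward M X r g y \<tau> \<le> (\<integral>\<^sup>+\<omega>. liminf (\<lambda>n. ?R n \<omega>) \<partial>M)"
    unfolding expected_reward_def
  proof (intro nn_integral_mono)
    fix \<omega> assume \<omega>: "\<omega> \<in> space M"
    show "ennreal (stopped_reward X r g y \<tau> \<omega>) \<le> liminf (\<lambda>n. ?R n \<omega>)"
    proof (cases "\<tau> \<omega>")
      case (real t)
      then have "?R n \<omega> = reward y (grid_round n (ennreal t)) \<omega>" for n
        by (simp add: sum_cells[OF \<omega>] discounted_gain_grid grid_round_def)
      then show ?thesis
        using real \<omega> by (simp add: stopped_reward_eq reward_le_liminf grid_round_tendsto grid_round_bounds)
    qed (simp add: stopped_reward_def)
  qed
  also have "\<dots> \<le> liminf (\<lambda>n. \<integral>\<^sup>+\<omega>. ?R n \<omega> \<partial>M)"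
    by (rule nn_integral_liminf) measurable
  also have "\<dots> \<le> liminf (\<lambda>n. c)"
  proof (intro Liminf_mono always_eventually allI)
    fix n
    have "(\<integral>\<^sup>+\<omega>. ?R n \<omega> \<partial>M) \<le>
        (\<integral>\<^sup>+\<omega>. (\<Sum>k. indicator (cell n \<tau> k) \<omega> * (discount n ^ k * w n (grid y n k \<omega>))) \<partial>M)"
      by (intro nn_integral_mono suminf_le mult_left_mono assms) auto
    also have "\<dots> \<le> w n y" by (rule supermartingale_bound[OF \<tau> assms(1,2)])
    also have "\<dots> \<le> c" by (rule assms)
    finally show "(\<integral>\<^sup>+\<omega>. ?R n \<omega> \<partial>M) \<le> c" .
  qed
  finally show "expected_reward M X r g y \<tau> \<le> c" by (simp add: Liminf_const)
qed

lemma expected_reward_le_value: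
  "stopping_time F \<tau> \<Longrightarrow> expected_reward M X r g y \<tau> \<le> value_function M F X r g y"
  unfolding value_function_def by (rule SUP_upper) simp

lemma gain_le_value: "gain y \<le> value_function M F X r g y"
proof -
  have "expected_reward M X r g y (\<lambda>_. 0) = (\<integral>\<^sup>+\<omega>. gain y \<partial>M)"
    unfolding expected_reward_def using starts_at_0
    by (intro nn_integral_cong_AE, eventually_elim) (simp add: stopped_reward_def gain_def)
  then show ?thesis
    using expected_reward_le_value[of "\<lambda>_. 0" y]
    by (simp add: emeasure_space_1 stopping_time_const)
qed

end

context monotone_stopping
begin

subsection \<open>The stopping regions of the grid problems\<close>

text \<open>
  Without discounting, \<open>ladder_mass = 1\<close> would mean that the walk exceeds every level at
  arbitrarily late times, contradicting \<open>g (Y\<^sub>t) \<rightarrow> 0\<close>.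
\<close>

lemma ladder_mass_less_1: "ladder_mass n < 1"
proof (cases "r = 0")
  case False
  have "ladder_mass n \<le> discount n" by (rule walk.ladder_mass_le)
  also have "\<dots> < 1"
    using False r_nonneg by (simp add: discount_def ennreal_less_one_iff)
  finally show ?thesis .
next
  case True
  then have disc: "discount n = 1" unfolding discount_def by simp
  obtain x where x: "b < ereal x" using exists_support by blast
  \<comment> \<open>As \<open>discount n = 1\<close>, this is the probability of being above
    \<open>x\<close> at some time, time 0 included.\<close>
  define e where "e = hit n {x<..} (\<lambda>_. 1)"
  have [measurable]: "e \<in> borel_measurable borel" by (simp add: e_def)
  show ?thesis
  proof (rule ccontr)
    assume "\<not> ladder_mass n < 1"
    then have mass: "ladder_mass n = 1"
      using walk.ladder_mass_le[of n] by (simp add: disc)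
    have ladder1: "trans n (hit n {u<..} (\<lambda>_. 1)) u = 1" for u
      using walk.ladder_1[of n u] by (simp add: walk.ladder_def mass)
    have e_le: "e u \<le> 1" for u unfolding e_def by (rule walk.hit_1_le)
    have trans_e_le: "trans n e u \<le> 1" for u
      using walk.trans_mono[of e "\<lambda>_. 1" n u] e_le walk.trans_1[of n u] by (simp add: disc)
    \<comment> \<open>Subharmonicity of \<open>e\<close>. The case above \<open>x\<close> uses the
      assumption to be refuted: a new maximum is certain, so the walk will be above \<open>x\<close>
      again after the next step.\<close>
    have super: "e u \<le> trans n e u" for u
    proof (cases "u \<le> x")
      case True
      then show ?thesis using walk.hit_out[of "{x<..}" "\<lambda>_. 1" u n] by (simp add: e_def)
    next
      case False
      have "hit n {u<..} (\<lambda>_. 1) v \<le> e v" for v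
      proof (rule walk.hit_least)
        show "1 \<le> e v" if "v \<in> {u<..}" for v
          using that False by (simp add: e_def walk.hit_in)
        show "trans n e v \<le> e v" for v
        proof (cases "v \<le> x")
          case True
          then show ?thesis using walk.hit_out[of "{x<..}" "\<lambda>_. 1" v n] by (simp add: e_def)
        next
          case False
          then show ?thesis using trans_e_le[of v] by (simp add: e_def walk.hit_in)
        qed
      qed
      then have "trans n (hit n {u<..} (\<lambda>_. 1)) u \<le> trans n e u"
        by (rule walk.trans_mono)
      then show ?thesis using e_le[of u] by (simp add: ladder1)
    qed
    define late where "late k \<omega> = (if \<exists>i\<ge>k. x < grid x n i \<omega> then 1 else 0 :: ennreal)" for k \<omega>
    have [measurable]: "late k \<in> borel_measurable M" for k
      unfolding late_def by measurable
    \<comment> \<open>By subharmonicity the expectation of \<open>e\<close> along the walk never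
      drops: at any time \<open>k\<close> it is still almost sure that the walk is above
      \<open>x\<close> then or later.\<close>
    have e_grid: "1 \<le> (\<integral>\<^sup>+\<omega>. e (grid x n k \<omega>) \<partial>M)" for k
    proof (induction k)
      case 0
      have "(\<integral>\<^sup>+\<omega>. e (grid x n 0 \<omega>) \<partial>M) = (\<integral>\<^sup>+\<omega>. e x \<partial>M)"
        using grid_0[of x n] by (intro nn_integral_cong_AE, eventually_elim) simp
      also have "e x = 1"
        using walk.hit_out[of "{x<..}" "\<lambda>_. 1" x n] ladder1[of x] by (simp add: e_def)
      finally show ?case by (simp add: emeasure_space_1)
    next
      case (Suc k)
      note Suc
      also have "(\<integral>\<^sup>+\<omega>. e (grid x n k \<omega>) \<partial>M) \<le> (\<integral>\<^sup>+\<omega>. trans n e (grid x n k \<omega>) \<partial>M)"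
        by (intro nn_integral_mono super)
      also have "\<dots> = (\<integral>\<^sup>+\<omega>. indicator (space M) \<omega> * (discount n ^ k * trans n e (grid x n k \<omega>)) \<partial>M)"
        by (intro nn_integral_cong) (simp add: disc)
      also have "\<dots> = (\<integral>\<^sup>+\<omega>. indicator (space M) \<omega> * (discount n ^ Suc k * e (grid x n (Suc k) \<omega>)) \<partial>M)"
        using sets.top[of "F (ennreal (real k / 2 ^ n))"]
        by (intro grid_markov[symmetric]) (simp_all add: space_F)
      also have "\<dots> = (\<integral>\<^sup>+\<omega>. e (grid x n (Suc k) \<omega>) \<partial>M)"
        by (intro nn_integral_cong) (simp add: disc)
      finally show ?case .
    qed
    have "1 \<le> (\<integral>\<^sup>+\<omega>. late k \<omega> \<partial>M)" for k
    proof -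
      have "(\<integral>\<^sup>+\<omega>. hit_within n N {x<..} (\<lambda>_. 1) (grid x n k \<omega>) \<partial>M) \<le> (\<integral>\<^sup>+\<omega>. late k \<omega> \<partial>M)" for N
      proof -
        have "(\<integral>\<^sup>+\<omega>. hit_within n N {x<..} (\<lambda>_. 1) (grid x n k \<omega>) \<partial>M) =
            (\<integral>\<^sup>+\<omega>. indicator (space M) \<omega> * (discount n ^ k * hit_within n N {x<..} (\<lambda>_. 1) (grid x n k \<omega>)) \<partial>M)"
          by (intro nn_integral_cong) (simp add: disc)
        also have "\<dots> = (\<integral>\<^sup>+\<omega>. indicator (space M) \<omega> * hit_reward x n {x<..} (\<lambda>_. 1) N k \<omega> \<partial>M)"
          using sets.top[of "F (ennreal (real k / 2 ^ n))"]
          by (intro hit_within_grid) (simp_all add: space_F)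
        also have "\<dots> \<le> (\<integral>\<^sup>+\<omega>. late k \<omega> \<partial>M)"
        proof (intro nn_integral_mono)
          fix \<omega> assume "\<omega> \<in> space M"
          have "hit_reward x n {x<..} (\<lambda>_. 1) N k \<omega> \<le> late k \<omega>"
            by (rule order_trans[OF hit_reward_le_SUP], rule SUP_least) (auto simp: late_def disc)
          then show "indicator (space M) \<omega> * hit_reward x n {x<..} (\<lambda>_. 1) N k \<omega> \<le> late k \<omega>"
            using \<open>\<omega> \<in> space M\<close> by simp
        qed
        finally show ?thesis .
      qed
      moreover have "incseq (\<lambda>N. hit_within n N {x<..} (\<lambda>_. 1) u)" for u
        by (rule walk.incseq_hit_within)
      then have "(\<integral>\<^sup>+\<omega>. e (grid x n k \<omega>) \<partial>M) =
          (SUP N. \<integral>\<^sup>+\<omega>. hit_within n N {x<..} (\<lambda>_. 1) (grid x n k \<omega>) \<partial>M)"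
        unfolding e_def walk.hit_def
        by (intro nn_integral_monotone_convergence_SUP) (auto simp: incseq_def le_fun_def)
      ultimately show ?thesis
        using e_grid[of k] by (metis (mono_tags, lifting) SUP_least order_trans)
    qed
    \<comment> \<open>Reverse Fatou turns this into visits above \<open>x\<close> at arbitrarily
      late times; each of them yields at least \<open>g x > 0\<close>, against the vanishing of the
      rewards.\<close>
    then have "1 \<le> limsup (\<lambda>k. \<integral>\<^sup>+\<omega>. late k \<omega> \<partial>M)"
      by (intro order_trans[OF _ Liminf_le_Limsup] Liminf_bounded always_eventually) auto
    also have "\<dots> \<le> (\<integral>\<^sup>+\<omega>. limsup (\<lambda>k. late k \<omega>) \<partial>M)"
      by (rule nn_integral_limsup[where w = "\<lambda>_. 1"])
        (auto simp: late_def emeasure_space_1)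
    also have "\<dots> = (\<integral>\<^sup>+\<omega>. 0 \<partial>M)"
    proof (rule nn_integral_cong_AE, use vanishing[of x] in eventually_elim)
      case (elim \<omega>)
      have "\<forall>\<^sub>F t in at_top. exp (- r * t) * g (x + X t \<omega>) < g x"
        using elim by (rule order_tendstoD) (simp add: g_pos_iff x)
      then obtain t0 where t0: "\<And>t. t0 \<le> t \<Longrightarrow> g (x + X t \<omega>) < g x"
        by (auto simp: eventually_at_top_linorder True)
      obtain k0 :: nat where k0: "t0 * 2 ^ n \<le> real k0" using real_arch_simple by blast
      have "late k \<omega> = 0" if "k0 \<le> k" for k
      proof -
        have "\<not> x < grid x n i \<omega>" if "k \<le> i" for i
        proof
          assume "x < grid x n i \<omega>"
          then have "g x \<le> g (grid x n i \<omega>)" by (intro monoD[OF mono_g]) simp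
          moreover have "t0 \<le> real i / 2 ^ n"
            using k0 \<open>k0 \<le> k\<close> \<open>k \<le> i\<close> by (simp add: field_simps)
          ultimately show False using t0[of "real i / 2 ^ n"] by (simp add: grid_def)
        qed
        then show ?thesis by (auto simp: late_def)
      qed
      then have "(\<lambda>k. late k \<omega>) \<longlonglongrightarrow> 0"
        by (intro tendsto_eventually eventually_sequentiallyI[of k0])
      then show ?case by (simp add: lim_imp_Limsup)
    qed
    finally show False by simp
  qed
qed

text \<open>Points where stopping is at least as good as waiting for the next ladder epoch. At or
  below \<open>b\<close> the comparison may just read \<open>0 \<le> 0\<close>, hence the support
  condition.\<close>

definition region :: "nat \<Rightarrow> real set" where
  "region n = {x. b < ereal x \<and> ladder n gain x \<le> gain x}"

definition grid_value :: "nat \<Rightarrow> real \<Rightarrow> ennreal" where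
  "grid_value n = hit n (region n) gain"

lemma ladder_gain_ratio:
  assumes "b < ereal x" "x \<le> z"
  shows "gain x * ladder n gain z \<le> gain z * ladder n gain x"
proof -
  have "gain x * gain (v + (z - x)) \<le> gain (x + (z - x)) * gain v" if "x < v" for v
    using g_ratio[of x v "z - x"] assms that
    by (simp add: gain_def ennreal_mult[symmetric] g_nonneg ennreal_leI)
  then show ?thesis
    using walk.ladder_ratio[of gain "z - x" x n] assms by simp
qed

lemma region_upward:
  assumes "x \<in> region n" "x \<le> z" shows "z \<in> region n"
proof -
  have x: "b < ereal x" "ladder n gain x \<le> gain x" using assms by (auto simp: region_def)
  have "gain x * ladder n gain z \<le> gain z * ladder n gain x"
    by (rule ladder_gain_ratio[OF x(1) assms(2)])
  also have "\<dots> \<le> gain x * gain z"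
    using x(2) by (subst mult.commute) (rule mult_right_mono, auto)
  finally have "ladder n gain z \<le> gain z"
    using gain_pos[OF x(1)] gain_finite(1)[of x] by (simp add: ennreal_mult_le_mult_iff)
  moreover have "b < ereal z" using order_less_le_trans[OF x(1), of "ereal z"] assms(2) by simp
  ultimately show ?thesis by (simp add: region_def)
qed

text \<open>With \<open>l\<close> and \<open>l'\<close> the ladder values at \<open>x\<close> and
  \<open>z\<close>, the ratio bound gives \<open>g z - l' \<ge> (g z / g x) * (g x - l)\<close>. The
  factor is at least 1, and \<open>g x - l \<ge> 0\<close> because \<open>x\<close> lies in the
  region.\<close>

lemma gain_minus_ladder_mono:
  assumes "x \<in> region n" "x \<le> z"
  shows "gain x - ladder n gain x \<le> gain z - ladder n gain z"
proof -
  have pos: "0 < g x" and le: "g x \<le> g z"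
    using assms by (auto simp: region_def g_pos_iff intro: monoD[OF mono_g])
  have "ladder n gain u \<le> gain u" if "u \<in> {x, z}" for u
    using that assms region_upward[OF assms] by (auto simp: region_def)
  then have "\<exists>l. ladder n gain u = ennreal l \<and> 0 \<le> l \<and> l \<le> g u" if "u \<in> {x, z}" for u
    using that by (cases "ladder n gain u") (force simp: gain_def ennreal_le_iff g_nonneg top_unique)+
  then obtain l l' where l: "ladder n gain x = ennreal l" "0 \<le> l" "l \<le> g x"
    and l': "ladder n gain z = ennreal l'" "0 \<le> l'" "l' \<le> g z"
    by blast
  have "ennreal (g x * l') \<le> ennreal (g z * l)"
    using ladder_gain_ratio[of x z n] assms l l'
    by (simp add: region_def gain_def ennreal_mult[symmetric] g_nonneg)
  then have "g x * l' \<le> g z * l"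
    using l g_nonneg by (simp add: ennreal_le_iff)
  moreover have "g x * (g x - l) \<le> g z * (g x - l)"
    using le l by (intro mult_right_mono) auto
  ultimately have "g x * (g x - l) \<le> g x * (g z - l')"
    by (simp add: algebra_simps)
  then have "g x - l \<le> g z - l'"
    using pos by simp
  then show ?thesis
    using l l' by (simp add: gain_def ennreal_minus ennreal_leI)
qed

lemma measurable_region [measurable]: "region n \<in> sets borel"
proof -
  have "mono (\<lambda>x. if x \<in> region n then 1 else 0 :: real)"
    by (auto simp: mono_def intro: region_upward)
  then have [measurable]: "(\<lambda>x. if x \<in> region n then 1 else 0 :: real) \<in> borel_measurable borel"
    by (rule borel_measurable_mono)
  have "region n = {x \<in> space borel. (if x \<in> region n then 1 else 0 :: real) = 1}"
    by auto
  also have "\<dots> \<in> sets borel" by measurable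
  finally show ?thesis .
qed

lemma measurable_grid_value [measurable]: "grid_value n \<in> borel_measurable borel"
  unfolding grid_value_def by simp

lemma grid_value_excessive: "trans n (grid_value n) x \<le> grid_value n x"
  unfolding grid_value_def
proof (rule walk.trans_hit_le_hit)
  show "\<exists>C<\<infinity>. \<forall>u\<le>x. hit n (region n) gain u \<le> C" for x
  proof (intro exI conjI allI impI)
    fix u :: real assume "u \<le> x"
    have "hit n (region n) gain u \<le> (\<integral>\<^sup>+\<omega>. envelope (-\<infinity>) u \<omega> \<partial>M)"
      by (rule hit_le_envelope) simp_all
    also have "\<dots> \<le> (\<integral>\<^sup>+\<omega>. envelope (-\<infinity>) x \<omega> \<partial>M)"
      using \<open>u \<le> x\<close> by (intro nn_integral_mono mono_envelope_arg)
    finally show "hit n (region n) gain u \<le> (\<integral>\<^sup>+\<omega>. envelope (-\<infinity>) x \<omega> \<partial>M)" .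
  qed (rule envelope_integrable)
  show "ladder n gain x \<le> gain x" if "x \<in> region n" for x
    using that by (simp add: region_def)
qed (simp_all add: ladder_mass_less_1 region_upward gain_minus_ladder_mono)

lemma le_ladder_outside_region: "u \<notin> region n \<Longrightarrow> gain u \<le> ladder n gain u"
  by (cases "b < ereal u") (auto simp: region_def gain_def g_eq_0)

text \<open>The region is an up-set, so it misses everything up to \<open>z\<close>. Hence waiting
  until the walk exceeds \<open>z\<close> is at least as good as stopping at once.\<close>

lemma gain_le_envelope_of_not_region:
  assumes "b < ereal z" "z \<notin> region n"
  shows "gain x \<le> (\<integral>\<^sup>+\<omega>. envelope z x \<omega> \<partial>M)"
proof -
  have "gain x \<le> hit n {z<..} gain x"
  proof (rule walk.le_hit_of_le_ladder)
    show "gain u \<le> gain z" "gain u \<le> ladder n gain u" if "u \<notin> {z<..}" for u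
      using that assms region_upward[of u n z] by (auto intro: monoD[OF mono_gain] le_ladder_outside_region)
  qed (auto simp: ladder_mass_less_1)
  also have "\<dots> \<le> (\<integral>\<^sup>+\<omega>. envelope z x \<omega> \<partial>M)"
    by (rule hit_le_envelope) simp_all
  finally show ?thesis .
qed

text \<open>The envelope bound does not depend on \<open>n\<close>: once the rewards above a level
  \<open>j\<close> are worth less than \<open>gain x\<close> at one fixed \<open>x\<close>, that
  level belongs to all regions. This makes the threshold finite.\<close>

lemma region_common_point: "\<exists>z. \<forall>n. z \<in> region n"
proof -
  obtain x where x: "b < ereal x" using exists_support by blast
  have "\<forall>\<^sub>F j in sequentially. (\<integral>\<^sup>+\<omega>. envelope (ereal (real j)) x \<omega> \<partial>M) < gain x"
    by (rule order_tendstoD(2)[OF envelope_vanishes gain_pos[OF x]])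
  then obtain j0 where j0: "\<And>j. j0 \<le> j \<Longrightarrow> (\<integral>\<^sup>+\<omega>. envelope (ereal (real j)) x \<omega> \<partial>M) < gain x"
    by (auto simp: eventually_sequentially)
  obtain j1 :: nat where j1: "x \<le> real j1" using real_arch_simple by blast
  define j where "j = max j0 j1"
  have "b < ereal (real j)"
    using order_less_le_trans[OF x, of "ereal (real j)"] j1 by (simp add: j_def)
  then have "real j \<in> region n" for n
    using gain_le_envelope_of_not_region[of "real j" n x] j0[of j]
    by (metis j_def linorder_not_le max.cobounded1)
  then show ?thesis by blast
qed

lemma gain_le_grid_value: "gain u \<le> grid_value n u"
proof -
  \<comment> \<open>A point of the up-set \<open>region n\<close> supplies the bound
    \<open>gain z\<close> for everything outside it.\<close>
  obtain z where z: "z \<in> region n" using region_common_point by blast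
  show ?thesis
    unfolding grid_value_def
  proof (rule walk.le_hit_of_le_ladder)
    show "gain u \<le> gain z" if "u \<notin> region n" for u
      using that region_upward[OF z, of u] by (intro monoD[OF mono_gain]) force
  qed (auto simp: ladder_mass_less_1 intro: region_upward le_ladder_outside_region)
qed

lemma grid_value_in_region: "x \<in> region n \<Longrightarrow> grid_value n x = gain x"
  unfolding grid_value_def by (rule walk.hit_in)

lemma mono_grid_value: "mono (grid_value n)"
  using gain_le_grid_value grid_value_excessive mono_gain
  unfolding grid_value_def by (intro walk.hit_mono_arg) auto

section \<open>Refining the grid, and the threshold in the limit\<close>

lemma trans_refine:
  assumes [measurable]: "f \<in> borel_measurable borel"
  shows "trans n f x = trans (Suc n) (trans (Suc n) f) x"
proof -
  have top: "space M \<in> sets (F t)" for t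
    using sets.top[of "F t"] by (simp add: space_F)
  have start: "(\<integral>\<^sup>+\<omega>. indicator (space M) \<omega> * (discount m ^ 0 * w (grid x m 0 \<omega>)) \<partial>M) = w x" for m and w :: "real \<Rightarrow> ennreal"
  proof -
    have "(\<integral>\<^sup>+\<omega>. indicator (space M) \<omega> * (discount m ^ 0 * w (grid x m 0 \<omega>)) \<partial>M) = (\<integral>\<^sup>+\<omega>. w x \<partial>M)"
      using grid_0[of x m] AE_space by (intro nn_integral_cong_AE, eventually_elim) simp
    then show ?thesis by (simp add: emeasure_space_1)
  qed
  have "trans n f x = (\<integral>\<^sup>+\<omega>. indicator (space M) \<omega> * (discount n ^ Suc 0 * f (grid x n (Suc 0) \<omega>)) \<partial>M)"
    by (subst grid_markov[OF top]) (simp_all only: start assms)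
  \<comment> \<open>One coarse step and two fine steps end at the same time, so both sides are
    expectations of the same discounted variable.\<close>
  also have "\<dots> = (\<integral>\<^sup>+\<omega>. indicator (space M) \<omega> * (discount (Suc n) ^ Suc (Suc 0) * f (grid x (Suc n) (Suc (Suc 0)) \<omega>)) \<partial>M)"
    unfolding discount_power grid_def by simp
  also have "\<dots> = trans (Suc n) (trans (Suc n) f) x"
    by (subst grid_markov[OF top assms], subst grid_markov[OF top]) (simp_all only: start walk.measurable_trans assms)
  finally show ?thesis .
qed

lemma grid_value_le_Suc: "grid_value n x \<le> grid_value (Suc n) x"
  unfolding grid_value_def[of n]
proof (rule walk.hit_least)
  show "trans n (grid_value (Suc n)) u \<le> grid_value (Suc n) u" for u
    by (subst trans_refine[OF measurable_grid_value])
      (rule order_trans[OF walk.trans_mono], (rule grid_value_excessive)+)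
qed (rule gain_le_grid_value)

lemma grid_value_mono_level: "m \<le> n \<Longrightarrow> grid_value m x \<le> grid_value n x"
  by (rule lift_Suc_mono_le[where f = "\<lambda>n. grid_value n x"]) (rule grid_value_le_Suc)

text \<open>Where the finer problem stops, its value is \<open>gain x\<close>. The coarse value lies
  below it and dominates a ladder step of the coarse walk.\<close>

lemma region_Suc_subset: "region (Suc n) \<subseteq> region n"
proof
  fix x assume x: "x \<in> region (Suc n)"
  have "ladder n gain x \<le> ladder n (grid_value n) x"
    by (intro walk.ladder_mono gain_le_grid_value)
  also have "\<dots> \<le> trans n (grid_value n) x"
    unfolding walk.ladder_def by (intro walk.trans_mono walk.hit_least grid_value_excessive) simp
  also have "\<dots> \<le> grid_value n x" by (rule grid_value_excessive)
  also have "\<dots> \<le> grid_value (Suc n) x" by (rule grid_value_le_Suc)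
  also have "\<dots> = gain x" by (rule grid_value_in_region[OF x])
  finally show "x \<in> region n" using x by (simp add: region_def)
qed

lemma region_antimono: "m \<le> n \<Longrightarrow> region n \<subseteq> region m"
  by (rule lift_Suc_antimono_le[where f = region]) (rule region_Suc_subset)

lemma value_le_SUP_grid_value: "value_function M F X r g y \<le> (SUP n. grid_value n y)"
  by (rule value_le[where w = grid_value])
    (auto intro: grid_value_excessive gain_le_grid_value SUP_upper)

lemma common_region_subset_stopping_set:
  assumes "\<And>n. x \<in> region n" shows "x \<in> stopping_set M F X r g"
  using value_le_SUP_grid_value[of x] gain_le_value[of x] assms
  by (simp add: stopping_set_def grid_value_in_region flip: gain_def)

lemma threshold_exists:
  obtains \<alpha> where "b < ereal \<alpha>" "\<And>n. {\<alpha><..} \<subseteq> region n"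
    "\<And>\<beta>. \<beta> < \<alpha> \<Longrightarrow> \<exists>n. region n \<subseteq> {\<beta><..}"
proof -
  define D where "D = (\<Inter>n. region n)"
  have up: "z \<in> D" if "x \<in> D" "x \<le> z" for x z
    using that region_upward by (auto simp: D_def)
  have ne: "D \<noteq> {}" using region_common_point by (auto simp: D_def)
  \<comment> \<open>At every point of \<open>D\<close> the value equals the gain, so non-triviality
    leaves a point \<open>c\<close> above \<open>b\<close> outside \<open>D\<close>.\<close>
  obtain c where c: "b < ereal c" "c \<notin> D"
  proof -
    obtain c where c: "b < ereal c" "ereal c < Inf (ereal ` stopping_set M F X r g)"
      using ereal_dense2[OF nontrivial] by blast
    have "c \<notin> D"
    proof
      assume "c \<in> D"
      then have "c \<in> stopping_set M F X r g"
        by (intro common_region_subset_stopping_set) (auto simp: D_def)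
      then have "Inf (ereal ` stopping_set M F X r g) \<le> ereal c" by (intro Inf_lower) auto
      then show False using c(2) by simp
    qed
    then show ?thesis using that c(1) by blast
  qed
  have lower: "c \<le> x" if "x \<in> D" for x
    using up[OF that, of c] c(2) by force
  \<comment> \<open>Whether \<open>Inf D\<close> itself belongs to \<open>D\<close> stays open,
    hence only the open half-line is claimed.\<close>
  show ?thesis
  proof (rule that[of "Inf D"])
    show "b < ereal (Inf D)"
      using order_less_le_trans[OF c(1), of "ereal (Inf D)"] cInf_greatest[OF ne lower] by simp
    show "{Inf D<..} \<subseteq> region n" for n
      using cInf_lessD[OF ne] up by (force simp: D_def)
    show "\<exists>n. region n \<subseteq> {\<beta><..}" if "\<beta> < Inf D" for \<beta>
    proof -
      have "\<beta> \<notin> D"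
        using that cInf_lower[of \<beta> D] lower by (auto simp: bdd_below_def)
      then obtain n where "\<beta> \<notin> region n" by (auto simp: D_def)
      then have "region n \<subseteq> {\<beta><..}" using region_upward[of _ n \<beta>] by force
      then show ?thesis by blast
    qed
  qed
qed

text \<open>The value is monotone and equals the gain strictly above \<alpha>. Approach
  \<open>max x \<alpha>\<close> from above; \<open>g\<close> is continuous there because \<alpha> >
  b.\<close>

lemma grid_value_le_gain_max:
  assumes \<alpha>: "b < ereal \<alpha>" "{\<alpha><..} \<subseteq> region n"
  shows "grid_value n x \<le> gain (max x \<alpha>)"
proof -
  define m where "m = max x \<alpha>"
  have "(\<lambda>k. m + 1 / real (Suc k)) \<longlonglongrightarrow> m + 0"
    by (intro tendsto_add tendsto_const LIMSEQ_Suc[OF lim_1_over_n])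
  moreover have "isCont g m"
    using order_less_le_trans[OF \<alpha>(1), of "ereal m"] by (intro isCont_g) (simp add: m_def)
  ultimately have "(\<lambda>k. g (m + 1 / real (Suc k))) \<longlonglongrightarrow> g m"
    by (metis add.right_neutral isCont_tendsto_compose)
  then have "(\<lambda>k. gain (m + 1 / real (Suc k))) \<longlonglongrightarrow> gain m"
    unfolding gain_def by (rule tendsto_ennrealI)
  moreover have "grid_value n x \<le> gain (m + 1 / real (Suc k))" for k
  proof -
    have less: "m < m + 1 / real (Suc k)" by simp
    have "grid_value n x \<le> grid_value n (m + 1 / real (Suc k))"
      using less max.cobounded1[of x \<alpha>, folded m_def] by (intro monoD[OF mono_grid_value]) linarith
    also have "\<dots> = gain (m + 1 / real (Suc k))"
      using less max.cobounded2[of \<alpha> x, folded m_def] by (intro grid_value_in_region subsetD[OF \<alpha>(2)], unfold greaterThan_iff) linarith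
    finally show ?thesis .
  qed
  ultimately show ?thesis
    unfolding m_def by (intro LIMSEQ_le_const) auto
qed

end

subsection \<open>Quasi-left-continuity and threshold times\<close>

text \<open>The times \<open>\<rho> j\<close> may lie on either side of \<open>t\<close>. If
  \<open>s\<close> stays below \<open>t\<close>, the left limit is identified along \<open>s\<close>
  as \<open>f t\<close>, so \<open>f\<close> is continuous at \<open>t\<close>; otherwise
  \<open>\<rho> j \<ge> t\<close> eventually.\<close>

lemma cadlag_tendsto_of_left_approx:
  fixes f :: "real \<Rightarrow> real"
  assumes rc: "continuous (at_right t) f" and ll: "0 < t \<Longrightarrow> \<exists>l. (f \<longlongrightarrow> l) (at_left t)"
    and s: "incseq s" "s \<longlonglongrightarrow> t" "\<And>j. 0 \<le> s j" "(\<lambda>j. f (s j)) \<longlonglongrightarrow> f t"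
    and \<rho>: "\<And>j. s j \<le> \<rho> j" "\<rho> \<longlonglongrightarrow> t"
  shows "(\<lambda>j. f (\<rho> j)) \<longlonglongrightarrow> f t"
proof (cases "\<exists>j0. s j0 = t")
  case True
  then obtain j0 where "s j0 = t" by blast
  then have "t \<le> \<rho> j" if "j0 \<le> j" for j
    using incseqD[OF s(1) that] \<rho>(1)[of j] by simp
  then show ?thesis
    by (intro right_continuous_sequentially[OF rc \<rho>(2)] eventually_sequentiallyI[of j0])
next
  case False
  then have less: "s j < t" for j
    using incseq_le[OF s(1,2), of j] by (metis order_le_less)
  then have "0 < t" using s(3) order_le_less_trans by blast
  then obtain l where l: "(f \<longlongrightarrow> l) (at_left t)" using ll by blast
  have "filterlim s (at_left t) sequentially"
    using s(2) less less_imp_neq[OF less] by (simp add: filterlim_at)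
  then have "(\<lambda>j. f (s j)) \<longlonglongrightarrow> l"
    by (rule filterlim_compose[OF l])
  then have "l = f t" using s(4) by (rule LIMSEQ_unique)
  then have "isCont f t"
    using l rc by (simp add: continuous_within filterlim_split_at)
  then show ?thesis using \<rho>(2) by (rule isCont_tendsto_compose)
qed

context levy_process
begin

lemma measurable_X_compose:
  assumes [measurable]: "\<rho> \<in> borel_measurable M" and nonneg: "\<And>\<omega>. 0 \<le> \<rho> \<omega>"
  shows "(\<lambda>\<omega>. X (\<rho> \<omega>) \<omega>) \<in> borel_measurable M"
proof (rule borel_measurable_LIMSEQ_real)
  show "(\<lambda>n. X (grid_round n (ennreal (\<rho> \<omega>))) \<omega>) \<longlonglongrightarrow> X (\<rho> \<omega>) \<omega>" if "\<omega> \<in> space M" for \<omega>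
    using that nonneg
    by (intro right_continuous_sequentially[OF right_continuous] grid_round_tendsto
        always_eventually allI grid_round_bounds)
  show "(\<lambda>\<omega>. X (grid_round n (ennreal (\<rho> \<omega>))) \<omega>) \<in> borel_measurable M" for n
    unfolding grid_round_def
  proof (rule measurable_compose_countable[where f = "\<lambda>k \<omega>. X (real k / 2 ^ n) \<omega>"])
    show "(\<lambda>\<omega>. grid_index n (ennreal (\<rho> \<omega>))) \<in> M \<rightarrow>\<^sub>M count_space UNIV"
      unfolding grid_index_def by measurable
  qed simp
qed

text \<open>A weak form of the strong Markov property.\<close>

lemma stopped_increment_le:
  fixes \<Phi> :: "real \<Rightarrow> real"
  assumes \<rho>: "\<And>\<omega>. 0 \<le> \<rho> \<omega>" "stopping_time F (\<lambda>\<omega>. ennreal (\<rho> \<omega>))" and "0 \<le> s"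
    and \<Phi>: "continuous_on UNIV \<Phi>"
  shows "(\<integral>\<^sup>+\<omega>. ennreal (\<Phi> (X (\<rho> \<omega> + s) \<omega> - X (\<rho> \<omega>) \<omega>)) \<partial>M) \<le> (\<integral>\<^sup>+\<omega>. ennreal (\<Phi> (X s \<omega>)) \<partial>M)"
proof -
  have [measurable]: "\<Phi> \<in> borel_measurable borel"
    using \<Phi> by (rule borel_measurable_continuous_onI)
  let ?t = "\<lambda>n k. real k / 2 ^ n" and ?\<tau> = "\<lambda>\<omega>. ennreal (\<rho> \<omega>)"
  let ?I = "\<lambda>n k \<omega>. ennreal (\<Phi> (X (?t n k + s) \<omega> - X (?t n k) \<omega>))"
  define c where "c = (\<integral>\<^sup>+\<omega>. ennreal (\<Phi> (X s \<omega>)) \<partial>M)"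
  have cF: "cell n ?\<tau> k \<in> sets (F (ennreal (?t n k)))" for n k
    by (rule cell_in_F[OF \<rho>(2)])
  then have [measurable]: "cell n ?\<tau> k \<in> sets M" for n k by (rule sets_F_imp_M)
  have [measurable]: "X s \<in> borel_measurable M" "X (?t n k) \<in> borel_measurable M"
      "X (?t n k + s) \<in> borel_measurable M" for n k
    using \<open>0 \<le> s\<close> by auto
  have "(\<integral>\<^sup>+\<omega>. ennreal (\<Phi> (X (\<rho> \<omega> + s) \<omega> - X (\<rho> \<omega>) \<omega>)) \<partial>M) \<le>
      (\<integral>\<^sup>+\<omega>. liminf (\<lambda>n. \<Sum>k. indicator (cell n ?\<tau> k) \<omega> * ?I n k \<omega>) \<partial>M)"
  proof (intro nn_integral_mono)
    fix \<omega> assume \<omega>: "\<omega> \<in> space M"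
    define R where "R n = grid_round n (?\<tau> \<omega>)" for n
    have R: "R \<longlonglongrightarrow> \<rho> \<omega>" "\<And>n. \<rho> \<omega> \<le> R n"
      unfolding R_def by (intro grid_round_tendsto grid_round_bounds \<rho>)+
    have "(\<lambda>n. X (R n + u) \<omega>) \<longlonglongrightarrow> X (\<rho> \<omega> + u) \<omega>" if "0 \<le> u" for u
      using R \<omega> \<rho>(1)[of \<omega>] that
      by (intro right_continuous_sequentially[OF right_continuous] tendsto_add tendsto_const
          always_eventually) auto
    from this[OF \<open>0 \<le> s\<close>] this[of 0]
    have "(\<lambda>n. X (R n + s) \<omega> - X (R n) \<omega>) \<longlonglongrightarrow> X (\<rho> \<omega> + s) \<omega> - X (\<rho> \<omega>) \<omega>"
      by (intro tendsto_diff) simp_all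
    then have "(\<lambda>n. \<Phi> (X (R n + s) \<omega> - X (R n) \<omega>)) \<longlonglongrightarrow> \<Phi> (X (\<rho> \<omega> + s) \<omega> - X (\<rho> \<omega>) \<omega>)"
      using \<Phi> by (intro isCont_tendsto_compose[where g = \<Phi>]) (auto simp: continuous_on_eq_continuous_at)
    then have "(\<lambda>n. ennreal (\<Phi> (X (R n + s) \<omega> - X (R n) \<omega>))) \<longlonglongrightarrow>
        ennreal (\<Phi> (X (\<rho> \<omega> + s) \<omega> - X (\<rho> \<omega>) \<omega>))"
      by (rule tendsto_ennrealI)
    moreover have "(\<Sum>k. indicator (cell n ?\<tau> k) \<omega> * ?I n k \<omega>) = ennreal (\<Phi> (X (R n + s) \<omega> - X (R n) \<omega>))" for n
      using \<omega> by (subst sum_cells) (auto simp: R_def grid_round_def)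
    ultimately show "ennreal (\<Phi> (X (\<rho> \<omega> + s) \<omega> - X (\<rho> \<omega>) \<omega>)) \<le>
        liminf (\<lambda>n. \<Sum>k. indicator (cell n ?\<tau> k) \<omega> * ?I n k \<omega>)"
      by (simp add: lim_imp_Liminf)
  qed
  also have "\<dots> \<le> liminf (\<lambda>n. \<integral>\<^sup>+\<omega>. (\<Sum>k. indicator (cell n ?\<tau> k) \<omega> * ?I n k \<omega>) \<partial>M)"
    by (rule nn_integral_liminf) measurable
  also have "(\<lambda>n. \<integral>\<^sup>+\<omega>. (\<Sum>k. indicator (cell n ?\<tau> k) \<omega> * ?I n k \<omega>) \<partial>M) = (\<lambda>n. c)"
  proof
    fix n
    \<comment> \<open>On a cell the increment starts at a constant grid time, and the cell is known
      by then. So the increment over length \<open>s\<close> is independent of the cell and has the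
      law of \<open>X s\<close>.\<close>
    have each: "(\<integral>\<^sup>+\<omega>. indicator (cell n ?\<tau> k) \<omega> * ?I n k \<omega> \<partial>M) = (\<integral>\<^sup>+\<omega>. indicator (cell n ?\<tau> k) \<omega> * c \<partial>M)" for k
    proof -
      note cF[of n k, measurable]
      have c_eq: "(\<integral>\<^sup>+u. ennreal (\<Phi> u) \<partial>distr M borel (X s)) = c"
        unfolding c_def by (subst nn_integral_distr) simp_all
      have "(\<integral>\<^sup>+\<omega>. indicator (cell n ?\<tau> k) \<omega> * ?I n k \<omega> \<partial>M) =
          (\<integral>\<^sup>+\<omega>. \<integral>\<^sup>+u. indicator (cell n ?\<tau> k) \<omega> * ennreal (\<Phi> u) \<partial>distr M borel (X s) \<partial>M)"
        using increment_nn_integral[of "?t n k" "?t n k + s"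
            "\<lambda>(\<omega>, u). indicator (cell n ?\<tau> k) \<omega> * ennreal (\<Phi> u)"] \<open>0 \<le> s\<close> by simp
      then show ?thesis by (simp add: nn_integral_cmult c_eq)
    qed
    have "(\<integral>\<^sup>+\<omega>. (\<Sum>k. indicator (cell n ?\<tau> k) \<omega> * ?I n k \<omega>) \<partial>M) =
        (\<Sum>k. \<integral>\<^sup>+\<omega>. indicator (cell n ?\<tau> k) \<omega> * ?I n k \<omega> \<partial>M)"
      by (rule nn_integral_suminf) measurable
    also have "\<dots> = (\<integral>\<^sup>+\<omega>. (\<Sum>k. indicator (cell n ?\<tau> k) \<omega> * c) \<partial>M)"
      unfolding each by (rule nn_integral_suminf[symmetric]) measurable
    also have "\<dots> = (\<integral>\<^sup>+\<omega>. c \<partial>M)"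
      by (intro nn_integral_cong) (subst sum_cells, simp_all)
    finally show "(\<integral>\<^sup>+\<omega>. (\<Sum>k. indicator (cell n ?\<tau> k) \<omega> * ?I n k \<omega>) \<partial>M) = c"
      by (simp add: emeasure_space_1)
  qed
  finally show ?thesis by (simp add: Liminf_const c_def)
qed

text \<open>
  If \<open>X\<close> jumped at the limit \<open>\<rho>\<close> of the announcing times \<open>\<rho>\<^sub>j\<close>, then the increments over
  \<open>[\<rho>\<^sub>j, \<rho>\<^sub>j + s]\<close> would not become small as \<open>s \<rightarrow> 0\<close>, although they are distributed like \<open>X\<^sub>s\<close>.
\<close>

lemma quasi_left_continuous:
  fixes \<rho> :: "nat \<Rightarrow> 'a \<Rightarrow> real"
  assumes \<rho>: "\<And>j \<omega>. 0 \<le> \<rho> j \<omega>" "\<And>j. stopping_time F (\<lambda>\<omega>. ennreal (\<rho> j \<omega>))"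
    and mono: "\<And>\<omega>. incseq (\<lambda>j. \<rho> j \<omega>)" and lim: "\<And>\<omega>. (\<lambda>j. \<rho> j \<omega>) \<longlonglongrightarrow> \<rho>' \<omega>"
  shows "AE \<omega> in M. (\<lambda>j. X (\<rho> j \<omega>) \<omega>) \<longlonglongrightarrow> X (\<rho>' \<omega>) \<omega>"
proof -
  \<comment> \<open>A bounded distance, so that the limit of small \<open>s\<close> can be taken
    under the integral without integrability of \<open>X s\<close>.\<close>
  define \<Phi> where "\<Phi> x = min 1 \<bar>x\<bar>" for x :: real
  have \<Phi>_cont: "continuous_on UNIV \<Phi>" unfolding \<Phi>_def by (intro continuous_intros)
  have [measurable]: "\<Phi> \<in> borel_measurable borel"
    using \<Phi>_cont by (rule borel_measurable_continuous_onI)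
  define s where "s i = 1 / real (Suc i)" for i
  have s: "0 < s i" for i by (simp add: s_def)
  have s_lim: "s \<longlonglongrightarrow> 0" unfolding s_def by (rule LIMSEQ_Suc[OF lim_1_over_n])
  define \<Psi> where "\<Psi> i j \<omega> = ennreal (\<Phi> (X (\<rho> j \<omega> + s i) \<omega> - X (\<rho> j \<omega>) \<omega>))" for i j \<omega>
  have [measurable]: "\<rho> j \<in> borel_measurable M" for j
  proof (rule borel_measurableI_le)
    fix a
    show "{\<omega> \<in> space M. \<rho> j \<omega> \<le> a} \<in> sets M"
    proof (cases "0 \<le> a")
      case True
      have "{\<omega> \<in> space M. ennreal (\<rho> j \<omega>) \<le> ennreal a} \<in> sets (F (ennreal a))"
        using stopping_timeD[OF \<rho>(2)[of j], of "ennreal a"] by (simp add: pred_def space_F)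
      then show ?thesis using True \<rho>(1) by (intro sets_F_imp_M[of _ a]) (simp add: ennreal_le_iff)
    next
      case False
      then have empty: "{\<omega> \<in> space M. \<rho> j \<omega> \<le> a} = {}" using \<rho>(1) by (auto dest: order_trans)
      show ?thesis by (simp only: empty sets.empty_sets)
    qed
  qed
  have [measurable]: "\<Psi> i j \<in> borel_measurable M" for i j
  proof -
    have [measurable]: "(\<lambda>\<omega>. X (\<rho> j \<omega> + s i) \<omega>) \<in> borel_measurable M"
      using \<rho>(1)[of j] s[of i] by (intro measurable_X_compose) (auto intro: add_nonneg_nonneg less_imp_le)
    have [measurable]: "(\<lambda>\<omega>. X (\<rho> j \<omega>) \<omega>) \<in> borel_measurable M"
      by (intro measurable_X_compose \<rho>) measurable
    show ?thesis unfolding \<Psi>_def by measurable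
  qed
  have "(\<integral>\<^sup>+\<omega>. liminf (\<lambda>i. liminf (\<lambda>j. \<Psi> i j \<omega>)) \<partial>M) \<le> liminf (\<lambda>i. \<integral>\<^sup>+\<omega>. liminf (\<lambda>j. \<Psi> i j \<omega>) \<partial>M)"
    by (rule nn_integral_liminf) measurable
  also have "\<dots> \<le> liminf (\<lambda>i. \<integral>\<^sup>+\<omega>. ennreal (\<Phi> (X (s i) \<omega>)) \<partial>M)"
  proof (intro Liminf_mono always_eventually allI)
    fix i
    have "(\<integral>\<^sup>+\<omega>. liminf (\<lambda>j. \<Psi> i j \<omega>) \<partial>M) \<le> liminf (\<lambda>j. \<integral>\<^sup>+\<omega>. \<Psi> i j \<omega> \<partial>M)"
      by (rule nn_integral_liminf) measurable
    also have "\<dots> \<le> liminf (\<lambda>j. \<integral>\<^sup>+\<omega>. ennreal (\<Phi> (X (s i) \<omega>)) \<partial>M)"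
      unfolding \<Psi>_def using s[of i]
      by (intro Liminf_mono always_eventually allI stopped_increment_le \<rho> \<Phi>_cont) simp
    finally show "(\<integral>\<^sup>+\<omega>. liminf (\<lambda>j. \<Psi> i j \<omega>) \<partial>M) \<le> (\<integral>\<^sup>+\<omega>. ennreal (\<Phi> (X (s i) \<omega>)) \<partial>M)"
      by (simp add: Liminf_const)
  qed
  also have "\<dots> = 0"
  proof -
    have [measurable]: "X (s i) \<in> borel_measurable M" for i using s[of i] by simp
    have "(\<lambda>i. \<integral>\<^sup>+\<omega>. ennreal (\<Phi> (X (s i) \<omega>)) \<partial>M) \<longlonglongrightarrow> (\<integral>\<^sup>+\<omega>. 0 \<partial>M)"
    proof (rule nn_integral_dominated_convergence[where w = "\<lambda>_. 1"])
      show "AE \<omega> in M. (\<lambda>i. ennreal (\<Phi> (X (s i) \<omega>))) \<longlonglongrightarrow> 0"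
        using starts_at_0 AE_space
      proof eventually_elim
        case (elim \<omega>)
        have "(\<lambda>i. X (s i) \<omega>) \<longlonglongrightarrow> X 0 \<omega>"
          using elim(2) s s_lim
          by (intro right_continuous_sequentially[OF right_continuous] always_eventually)
            (auto intro: less_imp_le)
        then have "(\<lambda>i. \<Phi> (X (s i) \<omega>)) \<longlonglongrightarrow> \<Phi> 0"
          using \<Phi>_cont elim(1)
          by (intro isCont_tendsto_compose[where g = \<Phi>]) (auto simp: continuous_on_eq_continuous_at)
        then show ?case using tendsto_ennrealI by (fastforce simp: \<Phi>_def)
      qed
    qed (auto simp: emeasure_space_1 \<Phi>_def)
    then show ?thesis by (simp add: lim_imp_Liminf)
  qed
  finally have "(\<integral>\<^sup>+\<omega>. liminf (\<lambda>i. liminf (\<lambda>j. \<Psi> i j \<omega>)) \<partial>M) = 0" by simp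
  then have "AE \<omega> in M. liminf (\<lambda>i. liminf (\<lambda>j. \<Psi> i j \<omega>)) = 0"
    by (subst (asm) nn_integral_0_iff_AE) measurable
  then show ?thesis
    using AE_space
  proof eventually_elim
    case (elim \<omega>)
    let ?f = "\<lambda>u. X u \<omega>" and ?t = "\<rho>' \<omega>"
    have le: "\<rho> j \<omega> \<le> ?t" for j by (rule incseq_le[OF mono lim])
    have t: "0 \<le> ?t" using le[of 0] \<rho>(1)[of 0 \<omega>] by simp
    show ?case
    proof (cases "\<exists>j0. \<rho> j0 \<omega> = ?t")
      case True
      then obtain j0 where "\<rho> j0 \<omega> = ?t" by blast
      then have "\<rho> j \<omega> = ?t" if "j0 \<le> j" for j
        using incseqD[OF mono that, of \<omega>] le[of j] by simp
      then show ?thesis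
        by (intro tendsto_eventually eventually_sequentiallyI[of j0]) simp
    next
      case False
      then have less: "\<rho> j \<omega> < ?t" for j using le[of j] by (metis order_le_less)
      then have "0 < ?t" using \<rho>(1) order_le_less_trans by blast
      then obtain l where l: "(?f \<longlongrightarrow> l) (at_left ?t)" using left_limits elim(2) by blast
      have "filterlim (\<lambda>j. \<rho> j \<omega>) (at_left ?t) sequentially"
        using lim less less_imp_neq[OF less] by (simp add: filterlim_at)
      then have to_l: "(\<lambda>j. ?f (\<rho> j \<omega>)) \<longlonglongrightarrow> l"
        by (rule filterlim_compose[OF l])
      have "l = ?f ?t"
      proof (rule ccontr)
        assume "l \<noteq> ?f ?t"
        define c where "c = \<bar>?f ?t - l\<bar>"
        have c: "0 < c" using \<open>l \<noteq> ?f ?t\<close> by (simp add: c_def)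
        have "(?f \<longlongrightarrow> ?f ?t) (at_right ?t)"
          using right_continuous[OF elim(2) t] by (simp add: continuous_within)
        then have "\<forall>\<^sub>F u in at_right ?t. dist (?f u) (?f ?t) < c / 4"
          using c by (intro tendstoD) simp_all
        then obtain d where d: "?t < d" "\<And>u. ?t < u \<Longrightarrow> u < d \<Longrightarrow> dist (?f u) (?f ?t) < c / 4"
          by (auto simp: eventually_at_right_field)
        have ev_i: "\<forall>\<^sub>F i in sequentially. s i < d - ?t"
          using d(1) by (intro order_tendstoD(2)[OF s_lim]) simp
        have ev_j: "\<forall>\<^sub>F j in sequentially. dist (?f (\<rho> j \<omega>)) l < c / 4"
          using c by (intro tendstoD[OF to_l]) simp
        \<comment> \<open>First \<open>s i\<close> is made small, then \<open>j\<close> late: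
          \<open>\<rho> j + s i\<close> lies just to the right of \<open>?t\<close> and
          \<open>\<rho> j\<close> just to its left, so the increment misses at most two quarters of
          the jump \<open>c\<close>.\<close>
        have "ennreal (min 1 (c / 2)) \<le> liminf (\<lambda>i. liminf (\<lambda>j. \<Psi> i j \<omega>))"
          using ev_i
        proof (intro Liminf_bounded, eventually_elim)
          fix i assume i: "s i < d - ?t"
          have "\<forall>\<^sub>F j in sequentially. ?t - s i < \<rho> j \<omega>"
            using s[of i] by (intro order_tendstoD(1)[OF lim]) simp
          then show "ennreal (min 1 (c / 2)) \<le> liminf (\<lambda>j. \<Psi> i j \<omega>)"
            using ev_j
          proof (intro Liminf_bounded, eventually_elim)
            fix j assume j: "?t - s i < \<rho> j \<omega>" "dist (?f (\<rho> j \<omega>)) l < c / 4"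
            have "dist (?f (\<rho> j \<omega> + s i)) (?f ?t) < c / 4"
              using i j(1) less[of j] by (intro d(2)) simp_all
            then have "c / 2 \<le> \<bar>?f (\<rho> j \<omega> + s i) - ?f (\<rho> j \<omega>)\<bar>"
              using j(2) unfolding c_def dist_real_def by (auto simp: abs_real_def split: if_splits)
            then show "ennreal (min 1 (c / 2)) \<le> \<Psi> i j \<omega>"
              unfolding \<Psi>_def \<Phi>_def by (intro ennreal_leI min.mono) simp_all
          qed
        qed
        then show False using elim(1) c by simp
      qed
      then show ?thesis using to_l by simp
    qed
  qed
qed

section \<open>Crossing times and threshold times under the usual conditions\<close>

lemma usual_right_continuous:
  assumes usual: "usual_conditions M F" and "0 \<le> t"
    and A: "\<And>u. t < u \<Longrightarrow> A \<in> sets (F (ennreal u))"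
  shows "A \<in> sets (F (ennreal t))"
proof -
  have "A \<in> sets (F v)" if "ennreal t < v" for v
  proof (cases v)
    case (real u)
    then show ?thesis using A[of u] that \<open>0 \<le> t\<close> by (simp add: ennreal_less_iff)
  next
    case top
    then show ?thesis using A[of "t + 1"] sets_F_mono[of "ennreal (t + 1)" v] by auto
  qed
  then have "A \<in> (\<Inter>v\<in>{ennreal t<..}. sets (F v))" by auto
  then show ?thesis using usual by (auto simp: usual_conditions_def)
qed

lemma stopping_timeI_less:
  assumes usual: "usual_conditions M F"
    and less: "\<And>t. 0 \<le> t \<Longrightarrow> {\<omega> \<in> space M. \<tau> \<omega> < ennreal t} \<in> sets (F (ennreal t))"
  shows "stopping_time F \<tau>"
proof (rule stopping_timeI)
  fix v :: ennreal
  show "Measurable.pred (F v) (\<lambda>\<omega>. \<tau> \<omega> \<le> v)"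
  proof (cases v)
    case (real t)
    have "{\<omega> \<in> space M. \<tau> \<omega> \<le> ennreal t} \<in> sets (F (ennreal t))"
    proof (rule usual_right_continuous[OF usual real(1)])
      fix u assume "t < u"
      define a where "a n = t + (u - t) / real (Suc n)" for n
      have a: "t < a n" "a n \<le> u" for n
        using \<open>t < u\<close> by (auto simp: a_def field_simps intro: mult_right_mono)
      have "(\<lambda>n. t + (u - t) * (1 / real (Suc n))) \<longlonglongrightarrow> t + (u - t) * 0"
        by (intro tendsto_intros LIMSEQ_Suc[OF lim_1_over_n])
      then have "a \<longlonglongrightarrow> t" by (simp add: a_def[abs_def])
      then have lim: "(\<lambda>n. ennreal (a n)) \<longlonglongrightarrow> ennreal t" by (rule tendsto_ennrealI)
      have "{\<omega> \<in> space M. \<tau> \<omega> \<le> ennreal t} = (\<Inter>n. {\<omega> \<in> space M. \<tau> \<omega> < ennreal (a n)})"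
      proof (intro set_eqI iffI)
        fix \<omega> assume "\<omega> \<in> {\<omega> \<in> space M. \<tau> \<omega> \<le> ennreal t}"
        moreover have "ennreal t < ennreal (a n)" for n
          using a(1)[of n] real(1) by (simp add: ennreal_less_iff)
        ultimately show "\<omega> \<in> (\<Inter>n. {\<omega> \<in> space M. \<tau> \<omega> < ennreal (a n)})"
          by (auto intro: order_le_less_trans)
      next
        fix \<omega> assume "\<omega> \<in> (\<Inter>n. {\<omega> \<in> space M. \<tau> \<omega> < ennreal (a n)})"
        then show "\<omega> \<in> {\<omega> \<in> space M. \<tau> \<omega> \<le> ennreal t}"
          using LIMSEQ_le_const[OF lim, of "\<tau> \<omega>"] by (auto intro: less_imp_le)
      qed
      also have "\<dots> \<in> sets (F (ennreal u))"
      proof (intro sets.countable_INT image_subsetI)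
        fix n
        show "{\<omega> \<in> space M. \<tau> \<omega> < ennreal (a n)} \<in> sets (F (ennreal u))"
          using less[of "a n"] a[of n] real(1) sets_F_mono[of "ennreal (a n)" "ennreal u"]
          by (auto simp: ennreal_leI)
      qed simp
      finally show "{\<omega> \<in> space M. \<tau> \<omega> \<le> ennreal t} \<in> sets (F (ennreal u))" .
    qed
    then show ?thesis using real by (simp add: pred_def space_F)
  qed simp
qed

text \<open>The strict inequality matters: by right continuity a crossing before \<open>t\<close> is
  then seen at a rational time before \<open>t\<close>, so countably many events suffice. With
  \<open>\<le>\<close>, as in \<open>threshold_time\<close>, this can fail.\<close>

definition crossing_time :: "real \<Rightarrow> real \<Rightarrow> 'a \<Rightarrow> ennreal" where
  "crossing_time \<beta> y \<omega> = Inf (ennreal ` {t. 0 \<le> t \<and> \<beta> < y + X t \<omega>})"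

lemma crossing_time_le: "0 \<le> t \<Longrightarrow> \<beta> < y + X t \<omega> \<Longrightarrow> crossing_time \<beta> y \<omega> \<le> ennreal t"
  unfolding crossing_time_def by (intro Inf_lower) auto

lemma stopping_time_crossing:
  assumes usual: "usual_conditions M F"
  shows "stopping_time F (crossing_time \<beta> y)"
proof (rule stopping_timeI_less[OF usual])
  fix t :: real assume t: "0 \<le> t"
  let ?Q = "{q \<in> \<rat>. 0 \<le> q \<and> q < t}"
  have "{\<omega> \<in> space M. crossing_time \<beta> y \<omega> < ennreal t} = (\<Union>q\<in>?Q. {\<omega> \<in> space M. \<beta> < y + X q \<omega>})"
  proof (intro set_eqI iffI)
    fix \<omega> assume \<omega>: "\<omega> \<in> {\<omega> \<in> space M. crossing_time \<beta> y \<omega> < ennreal t}"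
    then obtain s where s: "0 \<le> s" "\<beta> < y + X s \<omega>" "s < t"
      by (auto simp: crossing_time_def Inf_less_iff ennreal_less_iff)
    have "((\<lambda>u. y + X u \<omega>) \<longlongrightarrow> y + X s \<omega>) (at_right s)"
      using right_continuous[of \<omega> s] \<omega> s(1) by (intro tendsto_add tendsto_const) (simp add: continuous_within)
    then have "\<forall>\<^sub>F u in at_right s. \<beta> < y + X u \<omega>"
      using s(2) by (rule order_tendstoD)
    then obtain d where d: "s < d" "\<And>u. s < u \<Longrightarrow> u < d \<Longrightarrow> \<beta> < y + X u \<omega>"
      by (auto simp: eventually_at_right_field)
    obtain q where "q \<in> \<rat>" "s < q" "q < min d t"
      using Rats_dense_in_real[of s "min d t"] d(1) s(3) by auto
    then show "\<omega> \<in> (\<Union>q\<in>?Q. {\<omega> \<in> space M. \<beta> < y + X q \<omega>})"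
      using \<omega> s(1) d(2)[of q] by auto
  next
    fix \<omega> assume "\<omega> \<in> (\<Union>q\<in>?Q. {\<omega> \<in> space M. \<beta> < y + X q \<omega>})"
    then obtain q where q: "\<omega> \<in> space M" "0 \<le> q" "q < t" "\<beta> < y + X q \<omega>" by auto
    then show "\<omega> \<in> {\<omega> \<in> space M. crossing_time \<beta> y \<omega> < ennreal t}"
      using crossing_time_le[of q \<beta> y \<omega>] by (auto simp: ennreal_less_iff intro: order_le_less_trans)
  qed
  also have "\<dots> \<in> sets (F (ennreal t))"
  proof (intro sets.countable_UN'')
    show "countable ?Q" by (rule countable_subset[OF _ countable_rat]) auto
    fix q assume "q \<in> ?Q"
    then have [measurable]: "X q \<in> borel_measurable (F (ennreal t))" by (intro adapted_le) auto
    have "{\<omega> \<in> space (F (ennreal t)). \<beta> < y + X q \<omega>} \<in> sets (F (ennreal t))" by measurable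
    then show "{\<omega> \<in> space M. \<beta> < y + X q \<omega>} \<in> sets (F (ennreal t))" by (simp add: space_F)
  qed
  finally show "{\<omega> \<in> space M. crossing_time \<beta> y \<omega> < ennreal t} \<in> sets (F (ennreal t))" .
qed

lemma crossing_time_value:
  assumes \<omega>: "\<omega> \<in> space M" and t: "crossing_time \<beta> y \<omega> = ennreal t" "0 \<le> t"
  shows "\<beta> \<le> y + X t \<omega>"
proof (rule ccontr)
  assume less: "\<not> \<beta> \<le> y + X t \<omega>"
  have "((\<lambda>u. y + X u \<omega>) \<longlongrightarrow> y + X t \<omega>) (at_right t)"
    using right_continuous[OF \<omega> t(2)] by (intro tendsto_add tendsto_const) (simp add: continuous_within)
  then have "\<forall>\<^sub>F u in at_right t. y + X u \<omega> < \<beta>"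
    using less by (intro order_tendstoD) auto
  then obtain d where d: "t < d" "\<And>u. t < u \<Longrightarrow> u < d \<Longrightarrow> y + X u \<omega> < \<beta>"
    by (auto simp: eventually_at_right_field)
  have "ennreal d \<le> crossing_time \<beta> y \<omega>"
    unfolding crossing_time_def
  proof (rule Inf_greatest, clarify)
    fix s assume s: "0 \<le> s" "\<beta> < y + X s \<omega>"
    then have "t \<le> s" using crossing_time_le[OF s] t by (simp add: ennreal_le_iff)
    then have "\<not> s < d" using d(2)[of s] less s(2) by (cases "s = t") auto
    then show "ennreal d \<le> ennreal s" by (intro ennreal_leI) simp
  qed
  then show False using t d(1) by (simp add: ennreal_le_iff)
qed

lemma crossing_time_mono: "\<beta> \<le> \<beta>' \<Longrightarrow> crossing_time \<beta> y \<omega> \<le> crossing_time \<beta>' y \<omega>"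
  unfolding crossing_time_def by (intro Inf_superset_mono) auto

lemma crossing_time_le_threshold: "\<beta> < \<alpha> \<Longrightarrow> crossing_time \<beta> y \<omega> \<le> threshold_time X \<alpha> y \<omega>"
  unfolding crossing_time_def threshold_time_def by (intro Inf_superset_mono) auto

lemma threshold_time_approx:
  assumes usual: "usual_conditions M F"
    and \<beta>: "incseq \<beta>" "\<beta> \<longlonglongrightarrow> \<alpha>" "\<And>j. \<beta> j < \<alpha>"
  shows "AE \<omega> in M. threshold_time X \<alpha> y \<omega> = (SUP j. crossing_time (\<beta> j) y \<omega>) \<and>
    (threshold_time X \<alpha> y \<omega> < \<infinity> \<longrightarrow>
      \<alpha> \<le> y + X (enn2real (threshold_time X \<alpha> y \<omega>)) \<omega> \<and>
      (\<lambda>j. X (enn2real (crossing_time (\<beta> j) y \<omega>)) \<omega>) \<longlonglongrightarrow> X (enn2real (threshold_time X \<alpha> y \<omega>)) \<omega>)"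
proof -
  define \<tau> where "\<tau> j \<omega> = crossing_time (\<beta> j) y \<omega>" for j \<omega>
  define \<tau>' where "\<tau>' \<omega> = (SUP j. \<tau> j \<omega>)" for \<omega>
  \<comment> \<open>\<open>quasi_left_continuous\<close> wants finite times: truncate at every
    natural number \<open>N\<close> and discard the countably many null sets together.\<close>
  define \<rho> where "\<rho> N j \<omega> = enn2real (min (\<tau> j \<omega>) (ennreal (real N)))" for N j \<omega>
  define \<rho>' where "\<rho>' N \<omega> = enn2real (min (\<tau>' \<omega>) (ennreal (real N)))" for N \<omega>
  have inc: "incseq (\<lambda>j. \<tau> j \<omega>)" for \<omega>
    unfolding \<tau>_def using \<beta>(1) by (intro monoI crossing_time_mono) (auto simp: incseq_def)
  have fin: "min v (ennreal (real N)) < top" for v N by (simp add: min_less_iff_disj)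
  have lim: "(\<lambda>j. \<rho> N j \<omega>) \<longlonglongrightarrow> \<rho>' N \<omega>" for N \<omega>
  proof -
    have "(\<lambda>j. min (\<tau> j \<omega>) (ennreal (real N))) \<longlonglongrightarrow> min (\<tau>' \<omega>) (ennreal (real N))"
      unfolding \<tau>'_def by (intro tendsto_min LIMSEQ_SUP inc tendsto_const)
    then show ?thesis
      unfolding \<rho>_def \<rho>'_def by (intro tendsto_enn2real) (simp_all only: ennreal_enn2real[OF fin] enn2real_nonneg)
  qed
  have "AE \<omega> in M. (\<lambda>j. X (\<rho> N j \<omega>) \<omega>) \<longlonglongrightarrow> X (\<rho>' N \<omega>) \<omega>" for N
  proof (rule quasi_left_continuous)
    show "stopping_time F (\<lambda>\<omega>. ennreal (\<rho> N j \<omega>))" for j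
      unfolding \<rho>_def \<tau>_def ennreal_enn2real[OF fin]
      by (intro stopping_time_min stopping_time_crossing usual stopping_time_const)
    show "incseq (\<lambda>j. \<rho> N j \<omega>)" for \<omega>
      unfolding \<rho>_def using inc[of \<omega>] fin
      by (auto simp: incseq_def intro!: enn2real_mono min.mono)
  qed (auto simp: \<rho>_def intro: lim[unfolded \<rho>_def])
  then have "AE \<omega> in M. \<forall>N. (\<lambda>j. X (\<rho> N j \<omega>) \<omega>) \<longlonglongrightarrow> X (\<rho>' N \<omega>) \<omega>"
    by (simp add: AE_all_countable)
  then show ?thesis
    unfolding \<tau>_def[symmetric] \<tau>'_def[symmetric]
    using AE_space
  proof eventually_elim
    case (elim \<omega>)
    have below: "\<tau>' \<omega> \<le> threshold_time X \<alpha> y \<omega>"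
      unfolding \<tau>'_def \<tau>_def by (intro SUP_least crossing_time_le_threshold \<beta>)
    show ?case
    proof (cases "\<tau>' \<omega>")
      case top
      then show ?thesis using below by (simp add: top_unique)
    next
      case (real t)
      obtain N :: nat where "t \<le> real N" using real_arch_simple by blast
      then have N: "\<tau>' \<omega> \<le> ennreal (real N)" using real by (simp add: ennreal_leI)
      have le: "\<tau> j \<omega> \<le> \<tau>' \<omega>" for j unfolding \<tau>'_def by (rule SUP_upper) simp
      have \<rho>': "\<rho>' N \<omega> = t" using N real by (simp add: \<rho>'_def min_def)
      have \<rho>: "\<rho> N j \<omega> = enn2real (\<tau> j \<omega>)" for j
        using order_trans[OF le N, of j] by (simp add: \<rho>_def min_def)
      have X_lim: "(\<lambda>j. X (enn2real (\<tau> j \<omega>)) \<omega>) \<longlonglongrightarrow> X t \<omega>"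
        using elim(1)[rule_format, of N] by (simp add: \<rho> \<rho>')
      have "\<beta> j \<le> y + X (enn2real (\<tau> j \<omega>)) \<omega>" for j
      proof (rule crossing_time_value[OF elim(2)])
        have "\<tau> j \<omega> < top" using le[of j] real by (auto intro: order_le_less_trans)
        then show "crossing_time (\<beta> j) y \<omega> = ennreal (enn2real (\<tau> j \<omega>))"
          by (simp add: \<tau>_def)
      qed simp
      \<comment> \<open>The positions converge along with the levels, so the path is in the closed
        half-line at the limit of the crossing times; the threshold time is at most this
        limit.\<close>
      then have "\<alpha> \<le> y + X t \<omega>"
        by (intro LIMSEQ_le[OF \<beta>(2) tendsto_add[OF tendsto_const X_lim]]) auto
      moreover from this have "threshold_time X \<alpha> y \<omega> \<le> ennreal t"
        unfolding threshold_time_def using real(1) by (intro Inf_lower) auto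
      then have "threshold_time X \<alpha> y \<omega> = \<tau>' \<omega>" using below real by simp
      ultimately show ?thesis using real X_lim by simp
    qed
  qed
qed

text \<open>The event \<open>A\<close> for the threshold time differs from the adapted event
  \<open>B\<close> by a subset of a null set. Completeness and
  \<open>null_sets M \<subseteq> sets (F 0)\<close> absorb the difference.\<close>

lemma stopping_time_threshold:
  assumes usual: "usual_conditions M F"
  shows "stopping_time F (threshold_time X \<alpha> y)"
proof (rule stopping_timeI)
  fix t :: ennreal
  interpret complete_measure M using usual by (simp add: usual_conditions_def)
  define \<beta> where "\<beta> j = \<alpha> - 1 / real (Suc j)" for j
  have "(\<lambda>j. \<alpha> - 1 / real (Suc j)) \<longlonglongrightarrow> \<alpha> - 0"
    by (intro tendsto_diff tendsto_const LIMSEQ_Suc[OF lim_1_over_n])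
  then have \<beta>: "incseq \<beta>" "\<beta> \<longlonglongrightarrow> \<alpha>" "\<And>j. \<beta> j < \<alpha>"
    by (auto simp: \<beta>_def[abs_def] incseq_def frac_le)
  define A where "A = {\<omega> \<in> space M. threshold_time X \<alpha> y \<omega> \<le> t}"
  define B where "B = {\<omega> \<in> space M. (SUP j. crossing_time (\<beta> j) y \<omega>) \<le> t}"
  have "{\<omega> \<in> space M. crossing_time (\<beta> j) y \<omega> \<le> t} \<in> sets (F t)" for j
    using stopping_timeD[OF stopping_time_crossing[OF usual, of "\<beta> j" y], of t] by (simp add: pred_def space_F)
  then have "(\<Inter>j. {\<omega> \<in> space M. crossing_time (\<beta> j) y \<omega> \<le> t}) \<in> sets (F t)"
    by (intro sets.countable_INT) auto
  moreover have "(\<Inter>j. {\<omega> \<in> space M. crossing_time (\<beta> j) y \<omega> \<le> t}) = B"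
    by (auto simp: B_def SUP_le_iff)
  ultimately have B: "B \<in> sets (F t)" by simp
  have "A \<subseteq> B"
    unfolding A_def B_def
    by (auto intro!: SUP_least order_trans[OF crossing_time_le_threshold[OF \<beta>(3)]])
  obtain N where N: "N \<in> null_sets M"
    "{\<omega> \<in> space M. \<not> threshold_time X \<alpha> y \<omega> = (SUP j. crossing_time (\<beta> j) y \<omega>)} \<subseteq> N"
  proof -
    have "AE \<omega> in M. threshold_time X \<alpha> y \<omega> = (SUP j. crossing_time (\<beta> j) y \<omega>)"
      using threshold_time_approx[OF usual \<beta>, of y] by eventually_elim simp
    then show ?thesis using that by (auto elim!: AE_E simp: null_sets_def)
  qed
  have "B - A \<subseteq> N" using N(2) by (auto simp: A_def B_def)
  then have "B - A \<in> null_sets M"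
    using N(1) by (rule complete2)
  then have "B - A \<in> sets (F 0)" using usual by (auto simp: usual_conditions_def)
  then have "B - A \<in> sets (F t)" using sets_F_mono[of 0 t] by auto
  then have "B - (B - A) \<in> sets (F t)" using B by (rule sets.Diff[rotated])
  moreover have "B - (B - A) = A" using \<open>A \<subseteq> B\<close> by auto
  ultimately show "Measurable.pred (F t) (\<lambda>\<omega>. threshold_time X \<alpha> y \<omega> \<le> t)"
    by (simp add: pred_def space_F A_def)
qed

end

subsection \<open>Optimality of the threshold time\<close>

context monotone_stopping
begin

text \<open>Written as a sum over cells so that \<open>hit_within_grid\<close> applies to each
  summand; \<open>sampled_value_eq\<close> is the pathwise reading at the rounded crossing
  time.\<close>

definition sampled_value :: "real \<Rightarrow> nat \<Rightarrow> real \<Rightarrow> 'a \<Rightarrow> ennreal" where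
  "sampled_value y n \<beta> \<omega> =
    (\<Sum>k. indicator (cell n (crossing_time \<beta> y) k) \<omega> * (discount n ^ k * grid_value n (grid y n k \<omega>)))"

lemma measurable_crossing_cell [measurable]: "cell n (crossing_time \<beta> y) k \<in> sets M"
  using cell_in_F[OF stopping_time_crossing[OF usual]] by (rule sets_F_imp_M)

lemma measurable_sampled_value [measurable]: "sampled_value y n \<beta> \<in> borel_measurable M"
  unfolding sampled_value_def[abs_def] by measurable

lemma sampled_value_eq:
  assumes "\<omega> \<in> space M"
  shows "sampled_value y n \<beta> \<omega> = (if crossing_time \<beta> y \<omega> < \<infinity>
    then ennreal (exp (- r * grid_round n (crossing_time \<beta> y \<omega>))) *
      grid_value n (y + X (grid_round n (crossing_time \<beta> y \<omega>)) \<omega>) else 0)"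
  using assms by (simp add: sampled_value_def sum_cells discount_power grid_def grid_round_def)

text \<open>Before the crossing time of \<open>\<beta>\<close> the grid points lie outside the region.\<close>

lemma grid_value_le_sampled:
  assumes region: "region n \<subseteq> {\<beta><..}"
  shows "grid_value n y \<le> (\<integral>\<^sup>+\<omega>. sampled_value y n \<beta> \<omega> \<partial>M)"
proof -
  let ?cell = "cell n (crossing_time \<beta> y)" and ?R = "\<lambda>N k. hit_reward y n (region n) gain N k"
  have early: "grid y n i \<omega> \<notin> region n" if "ennreal (real i / 2 ^ n) < crossing_time \<beta> y \<omega>" for i \<omega>
  proof
    assume "grid y n i \<omega> \<in> region n"
    then have "crossing_time \<beta> y \<omega> \<le> ennreal (real i / 2 ^ n)"
      using region by (intro crossing_time_le) (auto simp: grid_def)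
    then show False using that by simp
  qed
  have split: "?R N 0 \<omega> \<le> (\<Sum>k. indicator (?cell k) \<omega> * ?R N k \<omega>)" if "\<omega> \<in> space M" for N \<omega>
  proof (cases "crossing_time \<beta> y \<omega> < \<infinity>")
    case True
    then show ?thesis
      using that by (simp add: sum_cells hit_reward_shift early less_grid_index)
  next
    case False
    \<comment> \<open>If \<beta> is never crossed, no grid point meets the region and nothing is
      collected.\<close>
    then have "grid y n i \<omega> \<notin> region n" for i
      by (intro early) (simp add: less_top[symmetric])
    then have "?R N 0 \<omega> \<le> 0"
      by (intro order_trans[OF hit_reward_le_SUP] SUP_least) simp
    then show ?thesis by simp
  qed
  have "(\<integral>\<^sup>+\<omega>. ?R N 0 \<omega> \<partial>M) \<le> (\<integral>\<^sup>+\<omega>. sampled_value y n \<beta> \<omega> \<partial>M)" for N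
  proof -
    have "(\<integral>\<^sup>+\<omega>. ?R N 0 \<omega> \<partial>M) \<le> (\<integral>\<^sup>+\<omega>. (\<Sum>k. indicator (?cell k) \<omega> * ?R N k \<omega>) \<partial>M)"
      by (intro nn_integral_mono split)
    also have "\<dots> = (\<Sum>k. \<integral>\<^sup>+\<omega>. indicator (?cell k) \<omega> * ?R N k \<omega> \<partial>M)"
      by (rule nn_integral_suminf) measurable
    also have "\<dots> = (\<Sum>k. \<integral>\<^sup>+\<omega>. indicator (?cell k) \<omega> *
        (discount n ^ k * hit_within n N (region n) gain (grid y n k \<omega>)) \<partial>M)"
      by (simp add: hit_within_grid[OF _ _ cell_in_F[OF stopping_time_crossing[OF usual]]])
    also have "\<dots> \<le> (\<Sum>k. \<integral>\<^sup>+\<omega>. indicator (?cell k) \<omega> * (discount n ^ k * grid_value n (grid y n k \<omega>)) \<partial>M)"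
      unfolding grid_value_def
      by (intro suminf_le nn_integral_mono mult_left_mono walk.hit_within_le_hit) auto
    also have "\<dots> = (\<integral>\<^sup>+\<omega>. sampled_value y n \<beta> \<omega> \<partial>M)"
      unfolding sampled_value_def by (rule nn_integral_suminf[symmetric]) measurable
    finally show ?thesis .
  qed
  then show ?thesis
    unfolding grid_value_def by (auto simp: hit_eq_SUP intro: SUP_least)
qed

text \<open>
  The second summand controls the discounted value \<open>g \<alpha>\<close> by a reward that is really collected,
  at the crossing of \<open>\<beta>\<close>. Without discounting this is what makes the bound vanish at infinity.
\<close>

lemma sampled_value_le:
  assumes \<alpha>: "b < ereal \<alpha>" "{\<alpha><..} \<subseteq> region n"
    and \<beta>: "b < ereal \<beta>0" "\<beta>0 \<le> \<beta>"
    and \<omega>: "\<omega> \<in> space M" and t: "crossing_time \<beta> y \<omega> = ennreal t" "0 \<le> t"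
  shows "sampled_value y n \<beta> \<omega> \<le>
    reward y (grid_round n (ennreal t)) \<omega> + ennreal (g \<alpha> / g \<beta>0) * reward y t \<omega>"
proof -
  let ?\<rho> = "grid_round n (ennreal t)"
  have pos: "0 < g \<beta>0" using \<beta>(1) by (simp add: g_pos_iff)
  have "g \<beta>0 \<le> g (y + X t \<omega>)"
    using crossing_time_value[OF \<omega> t] \<beta>(2) by (intro monoD[OF mono_g]) simp
  then have "g \<alpha> * g \<beta>0 \<le> g \<alpha> * g (y + X t \<omega>)"
    by (intro mult_left_mono g_nonneg)
  then have "g \<alpha> \<le> g \<alpha> / g \<beta>0 * g (y + X t \<omega>)"
    using pos by (simp add: field_simps)
  moreover have "exp (- r * ?\<rho>) \<le> exp (- r * t)"
    using grid_round_bounds(1)[OF t(2), of n] r_nonneg by (simp add: mult_left_mono)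
  ultimately have "exp (- r * ?\<rho>) * g \<alpha> \<le> exp (- r * t) * (g \<alpha> / g \<beta>0 * g (y + X t \<omega>))"
    using g_nonneg by (intro mult_mono) auto
  then have \<alpha>_le: "ennreal (exp (- r * ?\<rho>)) * gain \<alpha> \<le> ennreal (g \<alpha> / g \<beta>0) * reward y t \<omega>"
    using g_nonneg pos
    by (simp add: gain_def reward_def ennreal_mult[symmetric] ennreal_leI mult_ac)
  have "gain (max (y + X ?\<rho> \<omega>) \<alpha>) \<le> gain (y + X ?\<rho> \<omega>) + gain \<alpha>"
    by (cases "y + X ?\<rho> \<omega> \<le> \<alpha>") (auto simp: max_def)
  then have "grid_value n (y + X ?\<rho> \<omega>) \<le> gain (y + X ?\<rho> \<omega>) + gain \<alpha>"
    by (rule order_trans[OF grid_value_le_gain_max[OF \<alpha>]])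
  then have "sampled_value y n \<beta> \<omega> \<le> ennreal (exp (- r * ?\<rho>)) * (gain (y + X ?\<rho> \<omega>) + gain \<alpha>)"
    using t by (simp add: sampled_value_eq[OF \<omega>] mult_left_mono)
  also have "\<dots> \<le> reward y ?\<rho> \<omega> + ennreal (g \<alpha> / g \<beta>0) * reward y t \<omega>"
    using \<alpha>_le by (simp add: distrib_left reward_altdef add_left_mono)
  finally show ?thesis .
qed

lemma threshold_optimal:
  assumes \<alpha>: "b < ereal \<alpha>" "\<And>n. {\<alpha><..} \<subseteq> region n"
    and approx: "\<And>\<beta>. \<beta> < \<alpha> \<Longrightarrow> \<exists>n. region n \<subseteq> {\<beta><..}"
  shows "expected_reward M X r g y (threshold_time X \<alpha> y) = value_function M F X r g y"
proof (rule antisym)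
  show "expected_reward M X r g y (threshold_time X \<alpha> y) \<le> value_function M F X r g y"
    by (intro expected_reward_le_value stopping_time_threshold usual)
next
  \<comment> \<open>All levels stay above one \<open>\<beta>0\<close> in the support, so the
    constant \<open>C\<close> below has a positive denominator and is the same for all
    \<open>j\<close>.\<close>
  obtain \<beta>0 where \<beta>0: "b < ereal \<beta>0" "\<beta>0 < \<alpha>"
    using ereal_dense2[OF \<alpha>(1)] by auto
  define \<beta> where "\<beta> j = \<alpha> - (\<alpha> - \<beta>0) / real (Suc j)" for j
  have \<beta>_less: "\<beta> j < \<alpha>" for j using \<beta>0(2) by (simp add: \<beta>_def)
  have "(\<lambda>j. \<alpha> - (\<alpha> - \<beta>0) * (1 / real (Suc j))) \<longlonglongrightarrow> \<alpha> - (\<alpha> - \<beta>0) * 0"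
    by (intro tendsto_intros LIMSEQ_Suc[OF lim_1_over_n])
  then have \<beta>_lim: "\<beta> \<longlonglongrightarrow> \<alpha>" by (simp add: \<beta>_def[abs_def])
  have \<beta>_inc: "incseq \<beta>"
    using \<beta>0(2) by (auto simp: \<beta>_def[abs_def] incseq_def intro!: divide_left_mono)
  have \<beta>_ge: "\<beta>0 \<le> \<beta> j" for j
    using incseqD[OF \<beta>_inc, of 0 j] by (simp add: \<beta>_def)
  \<comment> \<open>Asking for \<open>n \<ge> j\<close> makes the mesh shrink as the level rises,
    and puts each fixed \<open>grid_value n y\<close> eventually below
    \<open>grid_value (m j) y\<close>.\<close>
  have "\<exists>n\<ge>j. region n \<subseteq> {\<beta> j<..}" for j
  proof -
    obtain n where "region n \<subseteq> {\<beta> j<..}" using approx[OF \<beta>_less] by blast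
    then have "region (max n j) \<subseteq> {\<beta> j<..}" using region_antimono[of n "max n j"] by auto
    then show ?thesis by (intro exI[of _ "max n j"]) simp
  qed
  then obtain m where m: "\<And>j. j \<le> m j" "\<And>j. region (m j) \<subseteq> {\<beta> j<..}"
    by metis
  define C where "C = g \<alpha> / g \<beta>0"
  have C: "0 \<le> C" by (simp add: C_def g_nonneg)
  define U where "U j = sampled_value y (m j) (\<beta> j)" for j
  define \<tau> where "\<tau> j \<omega> = crossing_time (\<beta> j) y \<omega>" for j \<omega>
  define T where "T = threshold_time X \<alpha> y"
  have U_le: "U j \<omega> \<le> reward y (grid_round (m j) (ennreal t)) \<omega> + ennreal C * reward y t \<omega>"
    if "\<omega> \<in> space M" "\<tau> j \<omega> = ennreal t" "0 \<le> t" for j \<omega> t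
    using sampled_value_le[OF \<alpha>(1,2) \<beta>0(1) \<beta>_ge that(1) that(2)[unfolded \<tau>_def] that(3)]
    unfolding U_def C_def .
  \<comment> \<open>The integrable majorant for the reverse Fatou step at the end.\<close>
  have dominated: "U j \<omega> \<le> (1 + ennreal C) * envelope (-\<infinity>) y \<omega>" if \<omega>: "\<omega> \<in> space M" for j \<omega>
  proof (cases "\<tau> j \<omega>")
    case (real t)
    have "U j \<omega> \<le> reward y (grid_round (m j) (ennreal t)) \<omega> + ennreal C * reward y t \<omega>"
      by (rule U_le[OF \<omega> real(2,1)])
    also have "\<dots> \<le> envelope (-\<infinity>) y \<omega> + ennreal C * envelope (-\<infinity>) y \<omega>"
      using real \<omega> by (intro add_mono mult_left_mono reward_le_envelope) auto
    finally show ?thesis by (simp add: distrib_right)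
  next
    case top
    then show ?thesis using \<omega> by (simp add: U_def sampled_value_eq \<tau>_def)
  qed
  have "AE \<omega> in M. limsup (\<lambda>j. U j \<omega>) \<le> ennreal (stopped_reward X r g y T \<omega>)"
    using threshold_time_approx[OF usual \<beta>_inc \<beta>_lim \<beta>_less, of y, folded T_def \<tau>_def]
      vanishing[of y] AE_space
  proof eventually_elim
    case (elim \<omega>)
    have T: "T \<omega> = (SUP j. \<tau> j \<omega>)" using elim(1) by simp
    have \<tau>_le: "\<tau> j \<omega> \<le> T \<omega>" for j unfolding T by (rule SUP_upper) simp
    have \<tau>_inc: "incseq (\<lambda>j. \<tau> j \<omega>)"
      unfolding \<tau>_def using \<beta>_inc by (intro monoI crossing_time_mono) (auto simp: incseq_def)
    then have \<tau>_lim: "(\<lambda>j. \<tau> j \<omega>) \<longlonglongrightarrow> T \<omega>" unfolding T by (rule LIMSEQ_SUP)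
    show ?case
    proof (cases "T \<omega>")
      case (real t)
      define s where "s j = enn2real (\<tau> j \<omega>)" for j
      define \<rho> where "\<rho> j = grid_round (m j) (\<tau> j \<omega>)" for j
      have \<tau>_fin: "\<tau> j \<omega> < top" for j using \<tau>_le[of j] real by (auto intro: order_le_less_trans)
      then have \<tau>: "\<tau> j \<omega> = ennreal (s j)" for j by (simp add: s_def)
      have s: "0 \<le> s j" for j by (simp add: s_def)
      have s_inc: "incseq s"
        unfolding s_def using \<tau>_inc \<tau>_fin by (auto simp: incseq_def intro!: enn2real_mono)
      have s_lim: "s \<longlonglongrightarrow> t"
        unfolding s_def using \<tau>_lim real by (intro tendsto_enn2real) auto
      have \<rho>_ge: "s j \<le> \<rho> j" and \<rho>_le: "\<rho> j \<le> s j + 1 / 2 ^ m j" for j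
        using grid_round_bounds[OF s[of j], of "m j"] by (simp_all add: \<rho>_def \<tau>)
      have \<rho>_lim: "\<rho> \<longlonglongrightarrow> t"
      proof (rule tendsto_sandwich[OF _ _ s_lim])
        show "(\<lambda>j. s j + 1 / 2 ^ j) \<longlonglongrightarrow> t"
          using tendsto_add[OF s_lim grid_mesh_tendsto] by simp
        have "1 / 2 ^ m j \<le> (1 / 2 ^ j :: real)" for j
          using m(1)[of j] by (intro divide_left_mono power_increasing) auto
        then show "\<forall>\<^sub>F j in sequentially. \<rho> j \<le> s j + 1 / 2 ^ j"
          using \<rho>_le by (intro always_eventually allI) (meson add_left_mono order_trans)
      qed (use \<rho>_ge in auto)
      have X_s: "(\<lambda>j. X (s j) \<omega>) \<longlonglongrightarrow> X t \<omega>" and above: "\<alpha> \<le> y + X t \<omega>"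
        using elim(1) real by (simp_all add: s_def)
      have "(\<lambda>j. X (\<rho> j) \<omega>) \<longlonglongrightarrow> X t \<omega>"
        using elim(3) real(1)
        by (intro cadlag_tendsto_of_left_approx[OF right_continuous left_limits s_inc s_lim s X_s \<rho>_ge \<rho>_lim])
      \<comment> \<open>Rounded positions may still be below \<alpha>, hence the maximum; it
        disappears in the limit, where the position is at least \<alpha>.\<close>
      then have "(\<lambda>j. max (y + X (\<rho> j) \<omega>) \<alpha>) \<longlonglongrightarrow> max (y + X t \<omega>) \<alpha>"
        by (intro tendsto_intros)
      moreover have "isCont g (y + X t \<omega>)"
        using order_less_le_trans[OF \<alpha>(1), of "ereal (y + X t \<omega>)"] above by (intro isCont_g) simp
      ultimately have "(\<lambda>j. g (max (y + X (\<rho> j) \<omega>) \<alpha>)) \<longlonglongrightarrow> g (y + X t \<omega>)"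
        using above by (intro isCont_tendsto_compose[of _ g]) (simp_all add: max_def)
      then have lim: "(\<lambda>j. ennreal (exp (- r * \<rho> j) * g (max (y + X (\<rho> j) \<omega>) \<alpha>))) \<longlonglongrightarrow> reward y t \<omega>"
        unfolding reward_def
        by (intro tendsto_ennrealI tendsto_mult tendsto_exp tendsto_const \<rho>_lim)
      have "U j \<omega> \<le> ennreal (exp (- r * \<rho> j) * g (max (y + X (\<rho> j) \<omega>) \<alpha>))" for j
        using mult_left_mono[OF grid_value_le_gain_max[OF \<alpha>, of "m j" "y + X (\<rho> j) \<omega>"],
            of "ennreal (exp (- r * \<rho> j))"] \<tau>_fin[of j] elim(3)
        by (simp add: U_def sampled_value_eq \<rho>_def \<tau>_def gain_def ennreal_mult g_nonneg)
      then have "limsup (\<lambda>j. U j \<omega>) \<le>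
          limsup (\<lambda>j. ennreal (exp (- r * \<rho> j) * g (max (y + X (\<rho> j) \<omega>) \<alpha>)))"
        by (intro Limsup_mono always_eventually allI)
      also have "\<dots> = reward y t \<omega>" using lim by (simp add: lim_imp_Limsup)
      finally show ?thesis using real by (simp add: stopped_reward_eq)
    next
      case top
      \<comment> \<open>The crossing times now tend to infinity (or are infinite, with
        \<open>U j \<omega> = 0\<close>), so both summands in \<open>U_le\<close> are rewards
        collected late.\<close>
      have "limsup (\<lambda>j. U j \<omega>) \<le> a" if "0 < a" for a
      proof -
        obtain c where c: "0 < c" "ennreal c \<le> a"
        proof -
          obtain a' where "0 < a'" "a' < a" using dense[OF \<open>0 < a\<close>] by blast
          then show ?thesis using that by (cases a') auto
        qed
        define \<delta> where "\<delta> = c / (1 + C)"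
        have "\<delta> * (1 + C) = c" using C by (simp add: \<delta>_def)
        then have "\<delta> + C * \<delta> = c" by (simp add: distrib_left mult.commute)
        moreover have "0 < \<delta>" using c(1) C by (simp add: \<delta>_def)
        ultimately have \<delta>: "0 < \<delta>" "\<delta> + C * \<delta> = c" by blast+
        have "\<forall>\<^sub>F t in at_top. exp (- r * t) * g (y + X t \<omega>) < \<delta>"
          using elim(2) \<delta>(1) by (rule order_tendstoD)
        then obtain t0 where t0: "\<And>t. t0 \<le> t \<Longrightarrow> exp (- r * t) * g (y + X t \<omega>) < \<delta>"
          by (auto simp: eventually_at_top_linorder)
        have small: "reward y t \<omega> \<le> ennreal \<delta>" if "t0 \<le> t" for t
          using t0[OF that] by (auto simp: reward_def intro: ennreal_leI)
        have "\<forall>\<^sub>F j in sequentially. ennreal t0 < \<tau> j \<omega>"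
          using \<tau>_lim top by (intro order_tendstoD(1)[of _ "T \<omega>"]) auto
        then have "\<forall>\<^sub>F j in sequentially. U j \<omega> \<le> a"
        proof eventually_elim
          fix j assume late: "ennreal t0 < \<tau> j \<omega>"
          show "U j \<omega> \<le> a"
          proof (cases "\<tau> j \<omega>")
            case (real t)
            then have t: "t0 \<le> t" using late ennreal_leI[of t t0] by (cases "t \<le> t0") (auto simp: not_le[symmetric])
            have "U j \<omega> \<le> reward y (grid_round (m j) (ennreal t)) \<omega> + ennreal C * reward y t \<omega>"
              by (rule U_le[OF elim(3) real(2,1)])
            also have "\<dots> \<le> ennreal \<delta> + ennreal C * ennreal \<delta>"
              using t grid_round_bounds(1)[OF real(1), of "m j"]
              by (intro add_mono mult_left_mono small) auto
            also have "\<dots> = ennreal c"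
              using \<delta> C by (simp add: ennreal_mult[symmetric] ennreal_plus[symmetric] del: ennreal_plus)
            finally show ?thesis using c(2) by simp
          next
            case top
            then show ?thesis using elim(3) by (simp add: U_def sampled_value_eq \<tau>_def)
          qed
        qed
        then show ?thesis by (rule Limsup_bounded)
      qed
      then have "limsup (\<lambda>j. U j \<omega>) \<le> 0"
        by (rule dense_ge)
      then show ?thesis by simp
    qed
  qed
  note limsup_le = this
  have "grid_value n y \<le> expected_reward M X r g y T" for n
  proof -
    have "\<forall>\<^sub>F j in sequentially. grid_value n y \<le> (\<integral>\<^sup>+\<omega>. U j \<omega> \<partial>M)"
    proof (rule eventually_sequentiallyI)
      fix j assume "n \<le> j"
      have "grid_value n y \<le> grid_value (m j) y"
        using \<open>n \<le> j\<close> m(1)[of j] by (intro grid_value_mono_level) simp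
      also have "\<dots> \<le> (\<integral>\<^sup>+\<omega>. U j \<omega> \<partial>M)"
        unfolding U_def by (rule grid_value_le_sampled[OF m(2)])
      finally show "grid_value n y \<le> (\<integral>\<^sup>+\<omega>. U j \<omega> \<partial>M)" .
    qed
    then have "grid_value n y \<le> liminf (\<lambda>j. \<integral>\<^sup>+\<omega>. U j \<omega> \<partial>M)"
      by (rule Liminf_bounded)
    also have "\<dots> \<le> limsup (\<lambda>j. \<integral>\<^sup>+\<omega>. U j \<omega> \<partial>M)"
      by (rule Liminf_le_Limsup) simp
    also have "\<dots> \<le> (\<integral>\<^sup>+\<omega>. limsup (\<lambda>j. U j \<omega>) \<partial>M)"
    proof (rule nn_integral_limsup)
      show "AE \<omega> in M. U j \<omega> \<le> (1 + ennreal C) * envelope (-\<infinity>) y \<omega>" for j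
        using dominated by (intro AE_I2)
      show "(\<integral>\<^sup>+\<omega>. (1 + ennreal C) * envelope (-\<infinity>) y \<omega> \<partial>M) < \<infinity>"
        using envelope_integrable[of "-\<infinity>" y]
        by (subst nn_integral_cmult) (auto simp: ennreal_mult_less_top)
    qed (auto simp: U_def)
    also have "\<dots> \<le> expected_reward M X r g y T"
      unfolding expected_reward_def using limsup_le by (rule nn_integral_mono_AE)
    finally show ?thesis .
  qed
  then show "value_function M F X r g y \<le> expected_reward M X r g y (threshold_time X \<alpha> y)"
    unfolding T_def[symmetric]
    by (intro order_trans[OF value_le_SUP_grid_value] SUP_least)
qed

end

theorem theorem8p1:
  fixes M :: "'a measure" and F :: "ennreal \<Rightarrow> 'a measure" and X :: "real \<Rightarrow> 'a \<Rightarrow> real"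
    and r :: real and g :: "real \<Rightarrow> real" and b :: ereal
  assumes "levy_process M F X" and "usual_conditions M F"
    and "r \<ge> 0"
    and "\<And>y. g y \<ge> 0"
    and "b \<noteq> \<infinity>" and "{y. g y > 0} = {y. ereal y > b}"
    and nontrivial: "Inf (ereal ` stopping_set M F X r g) > b"
    and increasing: "mono_on {y. ereal y > b} g"
    and log_concave: "concave_on {y. ereal y > b} (\<lambda>y. ln (g y))"
    and "\<And>y. (\<integral>\<^sup>+\<omega>. (SUP t\<in>{0..}. ennreal (exp (- r * t) * g (y + X t \<omega>))) \<partial>M) < \<infinity>"
    and "\<And>y. AE \<omega> in M. ((\<lambda>t. exp (- r * t) * g (y + X t \<omega>)) \<longlongrightarrow> 0) at_top"
  shows "\<exists>\<alpha>::real. ereal \<alpha> > b \<and>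
    (\<forall>y. stopping_time F (threshold_time X \<alpha> y) \<and>
         expected_reward M X r g y (threshold_time X \<alpha> y) = value_function M F X r g y)"
proof -
  interpret levy_process M F X by fact
  interpret monotone_stopping M F X r g b
    by unfold_locales (fact assms)+
  obtain \<alpha> where "b < ereal \<alpha>" "\<And>n. {\<alpha><..} \<subseteq> region n"
    "\<And>\<beta>. \<beta> < \<alpha> \<Longrightarrow> \<exists>n. region n \<subseteq> {\<beta><..}"
    using threshold_exists by blast
  then show ?thesis
    by (intro exI[of _ \<alpha>] conjI allI stopping_time_threshold threshold_optimal usual)
qed

end
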